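(* Let $T$ be a classical $n$-tangle with standard orientation. For any classical $n$-tangle $T'$ with compatible orientation and every $k>0$, the polynomial $f(\rho^k(T)\cup T')-f(T\cup T')$ is divisible in $\mathbb{Z}[A,A^{-1}]$ by the greatest common divisor of the set $\{f(T(r^k(m)))-f(T(m))\}_{m\in\mathcal{M}_n}$.
   Context: **Auxiliary polynomial.** For an oriented link diagram $D$, $f(D)=(-A^3)^{-w(D)}\langle D\rangle\in\mathbb{Z}[A,A^{-1}]$, where $w$ is the writhe and $\langle\cdot\rangle$ is the Kauffman bracket: at a crossing drawn so that the over-strand runs from bottom left to top right, $\langle D\rangle=A\langle D_A\rangle+A^{-1}\langle D_B\rangle$, where $D_A$ joins the two left ends together and the two right ends together, and $D_B$ joins the two top ends together and the two bottom ends together; $\langle\bigcirc\sqcup D\rangle=(-A^2-A^{-2})\langle D\rangle$; $\langle\bigcirc\rangle=1$. **Tangles.** A classical $n$-tangle is a tangle diagram (no virtual crossings) in a disk with $2n$ endpoints on the boundary circle, the $i$-th at angle $-\pi i/n$; closed components are allowed. $T\cup T'$ is the link diagram obtained by gluing the $i$-th endpoint of $T$ to the $i$-th endpoint of a complementary tangle $T'$ (planarly, so $T \cup T'$ is classical). $T$ has standard orientation if its endpoints $1,2,\dots,2n$ are alternately outbound, inbound, outbound, inbound, …; $T'$ has compatible orientation if the orientations of $T$ and $T'$ agree at the glued endpoints. **Rotation.** $r^k(T)$ is the rotation of $T$ clockwise by $k\pi/n$ radians. For $T$ with standard orientation, $\rho^k(T)=r^k(T)$ if $k$ is even, and if $k$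 is odd $\rho^k(T)$ is $r^k(T)$ with the orientation of every strand (including closed components) reversed; so $\rho^k(T)$ has standard orientation. **Matchings and closures.** $\mathcal{M}_n$ is the set of noncrossing perfect matchings of $\{1,\dots,2n\}$ (points at angles $-\pi i/n$ on the circle). $r^k(m)$ is the matching obtained by rotating $m$ counterclockwise by $k\pi/n$ radians, i.e. each pair $(i,j)$ becomes $(i-k,j-k)$ modulo $2n$. $T(m)$ is the link diagram obtained by joining the endpoints $i,j$ of $T$ by an arc outside the disk for each pair $(i,j)$ of $m$, without introducing crossings; it inherits the orientation of $T$. A gcd of zeros is $0$, and only $0$ is divisible by $0$. *)

theory Defs
  imports
    "HOL-Library.Poly_Mapping"
    "HOL-Library.Disjoint_Sets"
    "HOL-Combinatorics.Cycles"
    "HOL-Combinatorics.Orbits"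
begin

section \<open>The Laurent polynomial ring over the integers\<close>

text \<open>Finitely supported functions from exponents to coefficients, multiplied by convolution.\<close>

type_synonym laurent = "int \<Rightarrow>\<^sub>0 int"

definition lA :: laurent where
  "lA = Poly_Mapping.single 1 1"

definition lA_inv :: laurent where
  "lA_inv = Poly_Mapping.single (-1) 1"

text \<open>Greatest common divisors are determined only up to units, hence a predicate.
  The gcd of a set containing no nonzero element is \<open>0\<close>.\<close>

definition is_gcd :: "'a::comm_monoid_mult set \<Rightarrow> 'a \<Rightarrow> bool" where
  "is_gcd S g \<longleftrightarrow> (\<forall>s\<in>S. g dvd s) \<and> (\<forall>d. (\<forall>s\<in>S. d dvd s) \<longrightarrow> d dvd g)"


section \<open>Oriented diagrams\<close>

text \<open>Diagrams are given by planar diagram codes. The labels name the edges, that is, the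
  oriented arcs into which the curves of the diagram are cut by the crossings and by the
  joins. A join \<open>(x, y)\<close> is a marked point, not a crossing, at which edge \<open>x\<close> ends and
  edge \<open>y\<close> begins. A closed component without crossings is a closed chain of joins,
  for instance a single join \<open>(x, x)\<close>.

  With the over-strand drawn from bottom left to top right, a crossing is positive if the
  under-strand runs from bottom right to top left, and negative if it runs from top left
  to bottom right.\<close>

datatype 'a oriented_crossing =
  Crossing (positive: bool) (over_in: 'a) (over_out: 'a) (under_in: 'a) (under_out: 'a)

record 'a diagram =
  crossings :: "'a oriented_crossing list"
  joins :: "('a \<times> 'a) list"

definition writhe :: "'a oriented_crossing list \<Rightarrow> int" where
  "writhe cs = (\<Sum>c\<leftarrow>cs. if positive c then 1 else -1)"


subsection \<open>The Kauffman bracket and the auxiliary polynomial\<close>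

text \<open>In \<open>X a b c d\<close> the over-strand runs from the bottom left end \<open>a\<close> to the top right end
  \<open>c\<close>; the other ends are \<open>b\<close> at the bottom right and \<open>d\<close> at the top left. The direction
  of travel along the over-strand does not matter: \<open>X a b c d\<close> and \<open>X c d a b\<close> are the same
  crossing, turned by half a turn.\<close>

datatype 'a crossing = X 'a 'a 'a 'a

fun unoriented :: "'a oriented_crossing \<Rightarrow> 'a crossing" where
  "unoriented (Crossing True oi oo ui uo) = X oi ui oo uo"
| "unoriented (Crossing False oi oo ui uo) = X oi uo oo ui"

text \<open>In a diagram without crossings the circles are the connected components of the graph
  whose vertices are the labels and whose edges are the joins.\<close>

definition circles :: "('a \<times> 'a) list \<Rightarrow> nat" where
  "circles js = card (Field (set js) // (set js \<union> (set js)\<inverse>)\<^sup>*)"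

text \<open>The last argument collects the joins, here without orientation.\<close>

fun bracket :: "'a crossing list \<Rightarrow> ('a \<times> 'a) list \<Rightarrow> laurent" where
  "bracket [] js = (- (lA ^ 2) - lA_inv ^ 2) ^ (circles js - 1)"
| "bracket (X a b c d # cs) js =
     lA * bracket cs ((a, d) # (b, c) # js) + lA_inv * bracket cs ((d, c) # (a, b) # js)"

definition writhe_factor :: "int \<Rightarrow> laurent" where
  "writhe_factor w = (if w \<ge> 0 then (- (lA_inv ^ 3)) ^ nat w else (- (lA ^ 3)) ^ nat (- w))"

definition aux_poly :: "('a, 'b) diagram_scheme \<Rightarrow> laurent" where
  "aux_poly D =
     writhe_factor (writhe (crossings D)) * bracket (map unoriented (crossings D)) (joins D)"


section \<open>Tangles\<close>

text \<open>\<open>endpt i\<close> is the edge meeting the boundary at the \<open>i\<close>-th endpoint, and \<open>outbound i\<close> says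
  that it ends there, rather than begins there. Only the values at \<open>1, \<dots>, 2 * n\<close> matter.\<close>

record 'a tangle = "'a diagram" +
  endpt :: "nat \<Rightarrow> 'a"
  outbound :: "nat \<Rightarrow> bool"

definition endpoints :: "nat \<Rightarrow> nat list" where
  "endpoints n = [1..<2 * n + 1]"

definition heads :: "nat \<Rightarrow> 'a tangle \<Rightarrow> 'a list" where
  "heads n T = concat (map (\<lambda>c. [over_in c, under_in c]) (crossings T)) @ map fst (joins T)
     @ map (endpt T) (filter (outbound T) (endpoints n))"

definition tails :: "nat \<Rightarrow> 'a tangle \<Rightarrow> 'a list" where
  "tails n T = concat (map (\<lambda>c. [over_out c, under_out c]) (crossings T)) @ map snd (joins T)
     @ map (endpt T) (filter (\<lambda>i. \<not> outbound T i) (endpoints n))"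

text \<open>Every edge ends exactly once and begins exactly once.\<close>

definition well_formed :: "nat \<Rightarrow> 'a tangle \<Rightarrow> bool" where
  "well_formed n T \<longleftrightarrow>
     distinct (heads n T) \<and> distinct (tails n T) \<and> set (heads n T) = set (tails n T)"


subsection \<open>Absence of virtual crossings\<close>

text \<open>A combinatorial map on darts: the dart \<open>(x, True)\<close> is the end at which edge \<open>x\<close> arrives,
  and \<open>(x, False)\<close> the end at which it departs. The map is given by its vertices, each of
  them the list of its darts in counterclockwise order. It can be drawn on the sphere
  without further crossings iff each connected component has Euler characteristic 2; as no
  component can exceed 2, this says that the total is twice the number of components.
  Faces are the orbits of the permutation that passes to the other end of the edge and then
  to the next dart at the vertex reached. How the components are placed in each other's
  faces is not recorded; every placement is planar, and all of them have the same bracket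
  and writhe.\<close>

type_synonym 'a dart = "'a \<times> bool"

definition rotation :: "'a dart list list \<Rightarrow> 'a dart \<Rightarrow> 'a dart" where
  "rotation vs = foldr (\<lambda>v p. cycle_of_list v \<circ> p) vs id"

definition other_end :: "'a dart \<Rightarrow> 'a dart" where
  "other_end d = (fst d, \<not> snd d)"

definition planar_map :: "'a dart list list \<Rightarrow> bool" where
  "planar_map vs \<longleftrightarrow>
     (let D = set (concat vs);
          F = orbit (rotation vs \<circ> other_end) ` D;
          R = {(d, rotation vs d) | d. d \<in> D} \<union> {(d, other_end d) | d. d \<in> D};
          K = D // (R \<union> R\<inverse>)\<^sup>*
      in int (length vs) - int (card (fst ` D)) + int (card F) = 2 * int (card K))"

fun crossing_vertex :: "'a oriented_crossing \<Rightarrow> 'a dart list" where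
  "crossing_vertex (Crossing True oi oo ui uo) =
     [(oi, True), (ui, True), (oo, False), (uo, False)]"
| "crossing_vertex (Crossing False oi oo ui uo) =
     [(oi, True), (uo, False), (oo, False), (ui, True)]"

definition inner_vertices :: "'a tangle \<Rightarrow> 'a dart list list" where
  "inner_vertices T =
     map crossing_vertex (crossings T) @ map (\<lambda>(x, y). [(x, True), (y, False)]) (joins T)"

definition boundary_darts :: "nat \<Rightarrow> 'a tangle \<Rightarrow> 'a dart list" where
  "boundary_darts n T = map (\<lambda>i. (endpt T i, outbound T i)) (endpoints n)"

text \<open>The exterior of the disk is collapsed to one vertex at infinity. The endpoints follow each
  other clockwise on the circle, hence counterclockwise around infinity.\<close>

definition classical_tangle :: "nat \<Rightarrow> 'a tangle \<Rightarrow> bool" where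
  "classical_tangle n T \<longleftrightarrow>
     well_formed n T \<and> planar_map (boundary_darts n T # inner_vertices T)"

text \<open>A complementary tangle lies outside the disk and is attached to the same points of the
  circle. Now the disk is collapsed, and the cyclic order of the endpoints around the
  resulting vertex is the opposite one. \<open>outbound\<close> still means leaving the tangle, so here
  it means entering the disk.\<close>

definition classical_complement :: "nat \<Rightarrow> 'a tangle \<Rightarrow> bool" where
  "classical_complement n T \<longleftrightarrow>
     well_formed n T \<and> planar_map (rev (boundary_darts n T) # inner_vertices T)"


subsection \<open>Orientations and gluing\<close>

definition standard_orientation :: "nat \<Rightarrow> 'a tangle \<Rightarrow> bool" where
  "standard_orientation n T \<longleftrightarrow> (\<forall>i\<in>{1..2 * n}. outbound T i \<longleftrightarrow> odd i)"

definition compatible_orientation :: "nat \<Rightarrow> 'a tangle \<Rightarrow> 'b tangle \<Rightarrow> bool" where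
  "compatible_orientation n T T' \<longleftrightarrow> (\<forall>i\<in>{1..2 * n}. outbound T i \<longleftrightarrow> \<not> outbound T' i)"

definition glue :: "nat \<Rightarrow> 'a tangle \<Rightarrow> 'b tangle \<Rightarrow> ('a + 'b) diagram" where
  "glue n T T' = \<lparr>
     crossings = map (map_oriented_crossing Inl) (crossings T)
       @ map (map_oriented_crossing Inr) (crossings T'),
     joins = map (map_prod Inl Inl) (joins T) @ map (map_prod Inr Inr) (joins T')
       @ map (\<lambda>i. if outbound T i then (Inl (endpt T i), Inr (endpt T' i))
                  else (Inr (endpt T' i), Inl (endpt T i))) (endpoints n)\<rparr>"


subsection \<open>Rotation\<close>

text \<open>The index \<open>i - k\<close>, reduced modulo \<open>2 * n\<close> into \<open>1, \<dots>, 2 * n\<close>.\<close>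

definition shift_index :: "nat \<Rightarrow> nat \<Rightarrow> nat \<Rightarrow> nat" where
  "shift_index n k i = nat ((int i - int k - 1) mod (2 * int n)) + 1"

text \<open>Turning \<open>T\<close> clockwise brings its endpoint \<open>i - k\<close> to position \<open>i\<close>.\<close>

definition rotate_tangle :: "nat \<Rightarrow> nat \<Rightarrow> 'a tangle \<Rightarrow> 'a tangle" where
  "rotate_tangle n k T = T\<lparr>endpt := \<lambda>i. endpt T (shift_index n k i),
     outbound := \<lambda>i. outbound T (shift_index n k i)\<rparr>"

fun reverse_crossing :: "'a oriented_crossing \<Rightarrow> 'a oriented_crossing" where
  "reverse_crossing (Crossing p oi oo ui uo) = Crossing p oo oi uo ui"

definition reverse_tangle :: "'a tangle \<Rightarrow> 'a tangle" where
  "reverse_tangle T = T\<lparr>crossings := map reverse_crossing (crossings T),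
     joins := map prod.swap (joins T),
     outbound := \<lambda>i. \<not> outbound T i\<rparr>"

definition rho :: "nat \<Rightarrow> nat \<Rightarrow> 'a tangle \<Rightarrow> 'a tangle" where
  "rho n k T =
     (if even k then rotate_tangle n k T else reverse_tangle (rotate_tangle n k T))"


section \<open>Matchings and closures\<close>

definition perfect_matching :: "nat \<Rightarrow> nat set set \<Rightarrow> bool" where
  "perfect_matching n m \<longleftrightarrow> partition_on {1..2 * n} m \<and> (\<forall>e\<in>m. card e = 2)"

definition noncrossing :: "nat set set \<Rightarrow> bool" where
  "noncrossing m \<longleftrightarrow> \<not> (\<exists>a b c d. a < b \<and> b < c \<and> c < d \<and> {a, c} \<in> m \<and> {b, d} \<in> m)"

definition noncrossing_matchings :: "nat \<Rightarrow> nat set set set" where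
  "noncrossing_matchings n = {m. perfect_matching n m \<and> noncrossing m}"

definition rotate_matching :: "nat \<Rightarrow> nat \<Rightarrow> nat set set \<Rightarrow> nat set set" where
  "rotate_matching n k m = (\<lambda>e. shift_index n k ` e) ` m"

definition mate :: "nat set set \<Rightarrow> nat \<Rightarrow> nat" where
  "mate m i = (THE j. {i, j} \<in> m)"

text \<open>The orientation of \<open>T\<close> extends over the added arcs if exactly one endpoint of each pair is
  outbound. For standard orientation and a noncrossing matching this always holds, because
  noncrossing matchings pair odd with even indices.\<close>

definition closure_diagram :: "nat \<Rightarrow> 'a tangle \<Rightarrow> nat set set \<Rightarrow> 'a diagram" where
  "closure_diagram n T m = \<lparr>
     crossings = crossings T,
     joins = joins T @ map (\<lambda>i. (endpt T i, endpt T (mate m i)))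
       (filter (outbound T) (endpoints n))\<rparr>"

end

(* Resolving every crossing of T' writes T \<union> T' as a combination of closures of T: a crossingless
   state of T' is a noncrossing matching m of the endpoints together with closed curves, and its
   coefficient does not depend on T. Replacing T by its rotation replaces T(m) by T(r\<^sup>k(m)) and keeps
   the writhe, so the difference is a combination of the differences f(T(r\<^sup>k(m))) - f(T(m)).

   That the states of T' are noncrossing is a statement about combinatorial maps. Composing the
   vertex permutation with a transposition changes the numbers of vertices, faces and components
   in a controlled way. This yields the Euler inequality, and from it that splitting a vertex
   preserves genus 0 (smoothing a crossing is such a split), and that a split between two corners
   of one face disconnects the map. In a crossingless state the face to the left of the strand
   from a to c passes through the corner at a and the one next to c, so splitting the vertex at
   infinity there separates the endpoints between a and c from the others. *)

theory Submission
  imports Defs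
begin

text \<open>Planarity is given only as a numerical identity, so every geometric step has to become a
  count. A cycle of a permutation is therefore treated as a connected component of its graph:
  vertices, faces and components of a map are then all counted by the same statement about adding
  one edge to a relation. The linear combination of closures is never written down. Divisibility by
  \<open>g\<close> is stable under linear combinations, so the induction over the crossings of T'
  can carry divisibility itself. Orientations are dropped in it, because smoothings need not respect
  them; they matter only for the writhe and for choosing the direction of the closing arcs, which is
  settled by the parity of the endpoints. Without orientations, T and its rotation have the same
  crossings and joins and differ only in the map from positions to edges. Closing T along
  \<open>m\<close> through the shifted map is the same as closing T along the rotated
  matching.\<close>

section \<open>Counting connected components\<close>

text \<open>Reflexive on the whole type and not just on a vertex set, so that
  \<open>V // conn R\<close> has the form of the quotients in \<open>circles\<close> and
  \<open>planar_map\<close>.\<close>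

definition conn :: "'a rel \<Rightarrow> 'a rel" where
  "conn R = (R \<union> R\<inverse>)\<^sup>*"

definition component_count :: "'a set \<Rightarrow> 'a rel \<Rightarrow> nat" where
  "component_count V R = card (V // conn R)"

lemma conn_refl [simp]: "(x, x) \<in> conn R"
  by (simp add: conn_def)

lemma conn_sym: "(x, y) \<in> conn R \<Longrightarrow> (y, x) \<in> conn R"
  unfolding conn_def by (meson sym_Un_converse sym_rtrancl symE)

lemma conn_trans: "(x, y) \<in> conn R \<Longrightarrow> (y, z) \<in> conn R \<Longrightarrow> (x, z) \<in> conn R"
  unfolding conn_def by (rule rtrancl_trans)

lemma conn_edge: "(x, y) \<in> R \<Longrightarrow> (x, y) \<in> conn R"
  unfolding conn_def by auto

lemma conn_invariant:
  assumes "(x, y) \<in> conn R" and "\<And>u v. (u, v) \<in> R \<Longrightarrow> f u = f v"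
  shows "f x = f y"
  using assms(1) unfolding conn_def
  by (induction rule: rtrancl_induct) (use assms(2) in auto)

lemma conn_map:
  assumes "(x, y) \<in> conn R" and "\<And>u v. (u, v) \<in> R \<Longrightarrow> (f u, f v) \<in> conn S"
  shows "(f x, f y) \<in> conn S"
  using assms(1) unfolding conn_def
proof (induction rule: rtrancl_induct)
  case (step y z)
  from step.hyps(2) have "(f y, f z) \<in> conn S"
    using assms(2) conn_sym by fastforce
  with step.IH show ?case
    using conn_trans unfolding conn_def by metis
qed simp

lemma conn_least: "R \<subseteq> conn S \<Longrightarrow> conn R \<subseteq> conn S"
  using conn_map[where f = id and R = R and S = S] by auto

lemma conn_mono: "R \<subseteq> S \<Longrightarrow> conn R \<subseteq> conn S"
  by (rule conn_least) (auto intro: conn_edge)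

lemma conn_class_eq_iff: "conn R `` {x} = conn R `` {y} \<longleftrightarrow> (x, y) \<in> conn R"
proof
  show "(x, y) \<in> conn R" if "conn R `` {x} = conn R `` {y}"
    using that conn_refl[of y R] by blast
  show "conn R `` {x} = conn R `` {y}" if "(x, y) \<in> conn R"
    using conn_trans[OF that] conn_trans[OF conn_sym[OF that]] by blast
qed

lemma conn_closed:
  assumes "(x, y) \<in> conn R" and "x \<in> S" and "\<And>u v. (u, v) \<in> R \<Longrightarrow> u \<in> S \<longleftrightarrow> v \<in> S"
  shows "y \<in> S"
  using conn_invariant[OF assms(1), of "\<lambda>u. u \<in> S"] assms(2,3) by blast

text \<open>Components are counted by naming them. Since \<open>f\<close> need only distinguish
  components on \<open>V\<close>, the representative of a class is chosen inside
  \<open>V\<close>.\<close>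

lemma component_count_image:
  assumes "\<And>x y. x \<in> V \<Longrightarrow> y \<in> V \<Longrightarrow> (x, y) \<in> conn R \<longleftrightarrow> f x = f y"
  shows "component_count V R = card (f ` V)"
proof -
  let ?h = "\<lambda>c. f (SOME x. x \<in> V \<and> x \<in> c)"
  have h: "?h (conn R `` {x}) = f x" if "x \<in> V" for x
    using someI[of "\<lambda>y. y \<in> V \<and> y \<in> conn R `` {x}" x] that assms by fastforce
  have "bij_betw ?h (V // conn R) (f ` V)"
  proof (rule bij_betw_imageI)
    show "inj_on ?h (V // conn R)"
    proof (rule inj_onI)
      fix c d assume "c \<in> V // conn R" "d \<in> V // conn R" "?h c = ?h d"
      then obtain x y where "c = conn R `` {x}" "d = conn R `` {y}" "x \<in> V" "y \<in> V" "f x = f y"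
        using h by (auto elim!: quotientE)
      then show "c = d"
        using assms by (simp add: conn_class_eq_iff)
    qed
    show "?h ` (V // conn R) = f ` V"
      using h by (auto simp: quotient_def image_iff)
  qed
  then show ?thesis
    unfolding component_count_def by (rule bij_betw_same_card)
qed

lemma conn_insert_absorb: "(x, y) \<in> conn R \<Longrightarrow> conn (insert (x, y) R) = conn R"
  by (intro equalityI conn_least conn_mono) (auto simp: conn_edge)

lemma component_count_insert:
  assumes "finite V" "x \<in> V" "y \<in> V" "(x, y) \<notin> conn R"
  shows "component_count V R = component_count V (insert (x, y) R) + 1"
proof -
  \<comment> \<open>The new edge renames the class of \<open>y\<close> to that of \<open>x\<close>;
    exactly one class disappears from the image.\<close>
  define f where "f z = (if (z, y) \<in> conn R then conn R `` {x} else conn R `` {z})" for z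
  have xy: "(x, y) \<in> conn (insert (x, y) R)"
    by (simp add: conn_edge)
  have sub: "conn R \<subseteq> conn (insert (x, y) R)"
    by (rule conn_mono) auto
  have "(z, w) \<in> conn (insert (x, y) R) \<longleftrightarrow> f z = f w" for z w
  proof
    assume "(z, w) \<in> conn (insert (x, y) R)"
    then show "f z = f w"
    proof (rule conn_invariant)
      fix u v assume "(u, v) \<in> insert (x, y) R"
      then consider "u = x" "v = y" | "(u, v) \<in> conn R"
        by (auto intro: conn_edge)
      then show "f u = f v"
      proof cases
        case 1 then show ?thesis using assms(4) by (simp add: f_def)
      next
        case 2
        then have "(u, y) \<in> conn R \<longleftrightarrow> (v, y) \<in> conn R" using conn_trans conn_sym by metis
        then show ?thesis using 2 by (simp add: f_def conn_class_eq_iff)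
      qed
    qed
  next
    have yx: "(y, x) \<in> conn (insert (x, y) R)"
      using xy by (rule conn_sym)
    assume "f z = f w"
    then consider "(z, y) \<in> conn R" "(w, y) \<in> conn R" | "(z, y) \<in> conn R" "(x, w) \<in> conn R"
      | "(w, y) \<in> conn R" "(z, x) \<in> conn R" | "(z, w) \<in> conn R"
      by (auto simp: f_def conn_class_eq_iff split: if_splits)
    then show "(z, w) \<in> conn (insert (x, y) R)"
      using sub xy yx by cases (meson conn_sym conn_trans subsetD)+
  qed
  then have count: "component_count V (insert (x, y) R) = card (f ` V)"
    by (intro component_count_image)
  have image: "f ` V = V // conn R - {conn R `` {y}}"
  proof (intro equalityI subsetI)
    fix c assume "c \<in> f ` V"
    then obtain z where z: "z \<in> V" "c = f z" by auto
    show "c \<in> V // conn R - {conn R `` {y}}"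
      using z assms by (cases "(z, y) \<in> conn R") (simp_all add: f_def quotientI conn_class_eq_iff)
  next
    fix c assume c: "c \<in> V // conn R - {conn R `` {y}}"
    then obtain z where z: "z \<in> V" "c = conn R `` {z}"
      by (auto elim: quotientE)
    with c have "(z, y) \<notin> conn R" by (simp add: conn_class_eq_iff)
    with z show "c \<in> f ` V" by (simp add: f_def image_iff) blast
  qed
  have "conn R `` {y} \<in> V // conn R" "finite (V // conn R)"
    using assms by (simp_all add: quotientI) (simp add: quotient_def)
  then have "card (V // conn R) = Suc (card (V // conn R - {conn R `` {y}}))"
    by (intro card.remove)
  then show ?thesis
    using count image by (simp add: component_count_def[of V R])
qed


section \<open>The Euler characteristic of a combinatorial map\<close>

definition graph_on :: "'a set \<Rightarrow> ('a \<Rightarrow> 'a) \<Rightarrow> 'a rel" where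
  "graph_on D p = {(d, p d) | d. d \<in> D}"

definition cycle_count :: "'a set \<Rightarrow> ('a \<Rightarrow> 'a) \<Rightarrow> nat" where
  "cycle_count D p = component_count D (graph_on D p)"

lemma graph_on_iff [simp]: "(x, y) \<in> graph_on D p \<longleftrightarrow> x \<in> D \<and> y = p x"
  by (auto simp: graph_on_def)

text \<open>Lets cycles be counted as components. On a finite set some power of \<open>p\<close>
  undoes \<open>p\<close>, so a forward orbit is closed under backward steps as well.\<close>

lemma conn_graph_on_iff:
  assumes "finite D" "p permutes D" "x \<in> D"
  shows "(x, y) \<in> conn (graph_on D p) \<longleftrightarrow> y \<in> orbit p x"
proof
  have perm: "permutation p" using assms permutation_permutes by blast
  show "(x, y) \<in> conn (graph_on D p)" if "y \<in> orbit p x"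
    using that
  proof induction
    case (step z)
    then have "z \<in> D" using assms permutes_orbit_subset by fastforce
    then have "(z, p z) \<in> conn (graph_on D p)" by (simp add: conn_edge)
    with step.IH show ?case using conn_trans by metis
  qed (simp add: conn_edge assms)
  assume "(x, y) \<in> conn (graph_on D p)"
  then show "y \<in> orbit p x"
  proof (rule conn_closed)
    show "x \<in> orbit p x" using perm permutation_self_in_orbit by fast
    fix u v assume "(u, v) \<in> graph_on D p"
    then show "u \<in> orbit p x \<longleftrightarrow> v \<in> orbit p x"
      using perm by (metis graph_on_iff orbit.step orbit_swap permutation_orbit_step
          permutation_self_in_orbit orbit_trans)
  qed
qed

section \<open>Merging and splitting cycles by a transposition\<close>

lemma conn_funpow:
  assumes "p permutes D" "x \<in> D"
  shows "(x, (p ^^ n) x) \<in> conn (graph_on D p)"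
proof (induction n)
  case (Suc n)
  have "((p ^^ n) x, (p ^^ Suc n) x) \<in> conn (graph_on D p)"
    using assms by (simp add: conn_edge permutes_in_funpow_image)
  with Suc show ?case using conn_trans by metis
qed simp

text \<open>The step of \<open>p\<close> that would return to \<open>x\<close> is diverted to
  \<open>y\<close>. Between its start and that step the walk meets neither point, so both
  permutations agree along it.\<close>

lemma conn_transpose_merge:
  assumes "finite D" "p permutes D" "x \<in> D" "y \<in> D" "(x, y) \<notin> conn (graph_on D p)"
  shows "(x, y) \<in> conn (graph_on D (transpose x y \<circ> p))"
proof -
  let ?q = "transpose x y \<circ> p"
  have "permutation p" using assms permutation_permutes by blast
  then have "x \<in> orbit p x" by (rule permutation_self_in_orbit)
  then have "\<exists>n. 0 < n \<and> (p ^^ n) x = x" by (auto simp: orbit_altdef)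
  then obtain N where N: "0 < N" "(p ^^ N) x = x" and min: "\<And>m. m < N \<Longrightarrow> 0 < m \<Longrightarrow> (p ^^ m) x \<noteq> x"
    by (auto simp: exists_least_iff[of "\<lambda>n. 0 < n \<and> (p ^^ n) x = x"])
  have ny: "(p ^^ j) x \<noteq> y" for j using conn_funpow assms by metis
  have q: "?q permutes D"
    by (intro permutes_compose permutes_swap_id assms)
  have pow: "j < N \<Longrightarrow> (?q ^^ j) x = (p ^^ j) x" for j
  proof (induction j)
    case (Suc j)
    then show ?case using min[of "Suc j"] ny[of "Suc j"] by (simp add: transpose_def)
  qed simp
  obtain M where M: "N = Suc M" using N by (cases N) auto
  have "(?q ^^ N) x = y"
    using pow[of M] N M by simp
  then show ?thesis using conn_funpow[OF q assms(3)] by metis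
qed

text \<open>Here the step of \<open>p\<close> that would reach \<open>y\<close> for the first time
  is diverted back to \<open>x\<close>, so the cycle of \<open>x\<close> closes up before it
  contains \<open>y\<close>.\<close>

lemma conn_transpose_split:
  assumes "finite D" "p permutes D" "x \<in> D" "y \<in> D" "x \<noteq> y" "(x, y) \<in> conn (graph_on D p)"
  shows "(x, y) \<notin> conn (graph_on D (transpose x y \<circ> p))"
proof
  let ?q = "transpose x y \<circ> p"
  have q: "?q permutes D"
    by (intro permutes_compose permutes_swap_id assms)
  assume "(x, y) \<in> conn (graph_on D ?q)"
  then have "y \<in> orbit ?q x" using conn_graph_on_iff[OF assms(1) q assms(3)] by simp
  then have "\<exists>K. y = (?q ^^ K) x" unfolding orbit_altdef by blast
  then obtain K where K: "(?q ^^ K) x = y" by metis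
  have "y \<in> orbit p x" using conn_graph_on_iff assms by metis
  then have "\<exists>n. 0 < n \<and> (p ^^ n) x = y" by (auto simp: orbit_altdef)
  then obtain N where N: "0 < N" "(p ^^ N) x = y" and min: "\<And>m. m < N \<Longrightarrow> 0 < m \<Longrightarrow> (p ^^ m) x \<noteq> y"
    by (auto simp: exists_least_iff[of "\<lambda>n. 0 < n \<and> (p ^^ n) x = y"])
  have nx: "(p ^^ j) x \<noteq> x" if "0 < j" "j < N" for j
  proof
    assume "(p ^^ j) x = x"
    then have "(p ^^ (N - j)) x = y"
      using N that by (metis funpow_add comp_apply le_add_diff_inverse2 less_imp_le)
    then show False using min[of "N - j"] that by simp
  qed
  have pow: "j < N \<Longrightarrow> (?q ^^ j) x = (p ^^ j) x" for j
  proof (induction j)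
    case (Suc j)
    then show ?case using min[of "Suc j"] nx[of "Suc j"] by (simp add: transpose_def)
  qed simp
  obtain M where M: "N = Suc M" using N by (cases N) auto
  have "(?q ^^ N) x = x"
    using pow[of M] N M by simp
  then have "(?q ^^ (K mod N)) x = y" using K by (simp add: funpow_mod_eq)
  then have "(p ^^ (K mod N)) x = y" using pow[of "K mod N"] N by simp
  then show False using min[of "K mod N"] N assms(5) by (cases "K mod N = 0") auto
qed

text \<open>The two permutations differ by an exchange of the values \<open>x\<close> and
  \<open>y\<close>, which is invisible once these are joined. \<open>S\<close> is empty when cycles
  are counted, and the graph of the other permutation when components are.\<close>

lemma conn_insert_transpose:
  assumes "x \<in> D" "y \<in> D"
  shows "conn (insert (x, y) (graph_on D (transpose x y \<circ> p) \<union> S))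
       = conn (insert (x, y) (graph_on D p \<union> S))"
proof -
  have "conn (insert (x, y) (graph_on D p \<union> S))
      \<subseteq> conn (insert (x, y) (graph_on D (transpose x y \<circ> p) \<union> S))" (is "_ \<subseteq> conn ?R") for p
  proof (rule conn_least, rule subsetI, clarify)
    fix u v assume "(u, v) \<in> insert (x, y) (graph_on D p \<union> S)"
    then consider "(u, v) \<in> ?R" | "u \<in> D" "v = p u" by auto
    then show "(u, v) \<in> conn ?R"
    proof cases
      case 1 then show ?thesis by (rule conn_edge)
    next
      case 2
      have "(x, y) \<in> conn ?R" by (simp add: conn_edge)
      moreover have "(u, transpose x y v) \<in> conn ?R" using 2 by (intro conn_edge) simp
      ultimately show ?thesis
        by (metis conn_sym conn_trans transpose_apply_first transpose_apply_other transpose_apply_second)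
    qed
  qed
  from this[of p] this[of "transpose x y \<circ> p"] show ?thesis
    by (simp add: comp_assoc[symmetric])
qed

lemma cycle_count_merge:
  assumes "finite D" "p permutes D" "x \<in> D" "y \<in> D" "(x, y) \<notin> conn (graph_on D p)"
  shows "cycle_count D p = cycle_count D (transpose x y \<circ> p) + 1"
  using component_count_insert[OF assms(1,3,4,5)] conn_transpose_merge[OF assms]
    conn_insert_transpose[OF assms(3,4), of p "{}"]
  by (simp add: cycle_count_def conn_insert_absorb component_count_def)

lemma cycle_count_split:
  assumes "finite D" "p permutes D" "x \<in> D" "y \<in> D" "x \<noteq> y" "(x, y) \<in> conn (graph_on D p)"
  shows "cycle_count D (transpose x y \<circ> p) = cycle_count D p + 1"
  using component_count_insert[OF assms(1,3,4) conn_transpose_split[OF assms]]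
    conn_insert_transpose[OF assms(3,4), of p "{}"]
  by (simp add: cycle_count_def conn_insert_absorb assms(6) component_count_def)

text \<open>The two sides differ by twice the sum of the genera of the components when \<open>\<alpha>\<close> is a
  fixed-point free involution: then \<open>card D - cycle_count D \<alpha>\<close> is the number of edges.\<close>

definition euler_sum :: "'a set \<Rightarrow> ('a \<Rightarrow> 'a) \<Rightarrow> ('a \<Rightarrow> 'a) \<Rightarrow> nat" where
  "euler_sum D \<sigma> \<alpha> = cycle_count D \<sigma> + cycle_count D \<alpha> + cycle_count D (\<sigma> \<circ> \<alpha>)"

definition euler_bound :: "'a set \<Rightarrow> ('a \<Rightarrow> 'a) \<Rightarrow> ('a \<Rightarrow> 'a) \<Rightarrow> nat" where
  "euler_bound D \<sigma> \<alpha> = card D + 2 * component_count D (graph_on D \<sigma> \<union> graph_on D \<alpha>)"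

lemma conn_graph_on_comp:
  assumes "\<alpha> permutes D"
  shows "conn (graph_on D (\<sigma> \<circ> \<alpha>)) \<subseteq> conn (graph_on D \<sigma> \<union> graph_on D \<alpha>)"
proof (rule conn_least, rule subsetI, clarify)
  fix u v assume "(u, v) \<in> graph_on D (\<sigma> \<circ> \<alpha>)"
  then have u: "u \<in> D" and v: "v = \<sigma> (\<alpha> u)" by auto
  then have "\<alpha> u \<in> D" using assms by (simp add: permutes_in_image)
  then show "(u, v) \<in> conn (graph_on D \<sigma> \<union> graph_on D \<alpha>)"
    using u v by (auto intro!: conn_trans[OF conn_edge conn_edge, of u "\<alpha> u"])
qed

text \<open>Induction on the number of points moved by \<open>\<sigma>\<close>; the identity gives
  equality. Otherwise \<open>\<sigma>\<close> is a transposition after some \<open>\<tau>\<close>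
  that moves fewer points, and passing from \<open>\<tau>\<close> to \<open>\<sigma>\<close> loses
  one vertex. If \<open>x\<close> and \<open>y\<close> were already connected, at most one face is
  gained and the bound is unchanged. If not, a face and a component are lost too, and both sides
  drop by 2.\<close>

theorem euler_inequality:
  assumes "finite D" "\<sigma> permutes D" "\<alpha> permutes D"
  shows "euler_sum D \<sigma> \<alpha> \<le> euler_bound D \<sigma> \<alpha>"
  using assms(2)
proof (induction "card {x \<in> D. \<sigma> x \<noteq> x}" arbitrary: \<sigma> rule: less_induct)
  case less
  show ?case
  proof (cases "\<exists>x\<in>D. \<sigma> x \<noteq> x")
    case False
    then have id: "\<sigma> = id" using less.prems by (fastforce simp: permutes_def)
    have "conn (graph_on D id) \<subseteq> conn {}" by (rule conn_least) auto
    then have "cycle_count D id = card (id ` D)"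
      unfolding cycle_count_def
      by (intro component_count_image) (auto simp: conn_def)
    moreover have "conn (graph_on D id \<union> graph_on D \<alpha>) = conn (graph_on D \<alpha>)"
      by (intro equalityI conn_least conn_mono) (auto simp: conn_edge)
    ultimately show ?thesis
      by (simp add: euler_sum_def euler_bound_def id cycle_count_def component_count_def)
  next
    case True
    then obtain x where x: "x \<in> D" "\<sigma> x \<noteq> x" by auto
    define y where "y = \<sigma> x"
    define \<tau> where "\<tau> = transpose x y \<circ> \<sigma>"
    have y: "y \<in> D" using x less.prems by (simp add: y_def permutes_in_image)
    have \<tau>: "\<tau> permutes D"
      unfolding \<tau>_def by (intro permutes_compose permutes_swap_id less.prems x y)
    have \<sigma>: "\<sigma> = transpose x y \<circ> \<tau>"
      by (simp add: \<tau>_def comp_assoc[symmetric])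
    have \<tau>x: "\<tau> x = x" by (simp add: \<tau>_def y_def)
    have "{z \<in> D. \<tau> z \<noteq> z} \<subset> {z \<in> D. \<sigma> z \<noteq> z}"
    proof
      show "{z \<in> D. \<tau> z \<noteq> z} \<subseteq> {z \<in> D. \<sigma> z \<noteq> z}"
        using less.prems x by (auto simp: \<tau>_def y_def transpose_def permutes_def split: if_splits)
      show "{z \<in> D. \<tau> z \<noteq> z} \<noteq> {z \<in> D. \<sigma> z \<noteq> z}"
        using x \<tau>x by auto
    qed
    then have IH: "euler_sum D \<tau> \<alpha> \<le> euler_bound D \<tau> \<alpha>"
      using less.hyps \<tau> assms(1) by (simp add: psubset_card_mono)
    have "orbit \<tau> x = {x}" using \<tau>x by (simp add: orbit_eq_singleton_iff)
    then have "(x, y) \<notin> conn (graph_on D \<tau>)"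
      using conn_graph_on_iff[OF assms(1) \<tau> x(1)] x(2) by (simp add: y_def)
    note V = cycle_count_merge[OF assms(1) \<tau> x(1) y this, folded \<sigma>]
    have \<phi>: "\<tau> \<circ> \<alpha> permutes D" using \<tau> assms(3) permutes_compose by blast
    have \<sigma>\<alpha>: "\<sigma> \<circ> \<alpha> = transpose x y \<circ> (\<tau> \<circ> \<alpha>)" by (simp add: \<sigma> comp_assoc)
    have "(x, y) \<in> conn (graph_on D \<sigma> \<union> graph_on D \<alpha>)"
      using x by (intro conn_edge) (simp add: y_def)
    then have C: "component_count D (graph_on D \<sigma> \<union> graph_on D \<alpha>)
        = component_count D (insert (x, y) (graph_on D \<tau> \<union> graph_on D \<alpha>))"
      using conn_insert_transpose[OF x(1) y, of \<tau> "graph_on D \<alpha>", folded \<sigma>]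
      by (simp add: component_count_def conn_insert_absorb)
    show ?thesis
    proof (cases "(x, y) \<in> conn (graph_on D \<tau> \<union> graph_on D \<alpha>)")
      case True
      then have C': "component_count D (graph_on D \<sigma> \<union> graph_on D \<alpha>)
        = component_count D (graph_on D \<tau> \<union> graph_on D \<alpha>)"
        using C by (simp add: component_count_def conn_insert_absorb)
      have "cycle_count D (\<sigma> \<circ> \<alpha>) \<le> cycle_count D (\<tau> \<circ> \<alpha>) + 1"
        using cycle_count_merge[OF assms(1) \<phi> x(1) y] cycle_count_split[OF assms(1) \<phi> x(1) y] x(2)
        unfolding \<sigma>\<alpha> by (cases "(x, y) \<in> conn (graph_on D (\<tau> \<circ> \<alpha>))") (auto simp: y_def)
      then show ?thesis using IH V C' by (simp add: euler_sum_def euler_bound_def)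
    next
      case False
      then have "(x, y) \<notin> conn (graph_on D (\<tau> \<circ> \<alpha>))"
        using conn_graph_on_comp[OF assms(3)] by blast
      then have "cycle_count D (\<tau> \<circ> \<alpha>) = cycle_count D (\<sigma> \<circ> \<alpha>) + 1"
        unfolding \<sigma>\<alpha> by (rule cycle_count_merge[OF assms(1) \<phi> x(1) y])
      then show ?thesis using IH V C component_count_insert[OF assms(1) x(1) y False]
        by (simp add: euler_sum_def euler_bound_def)
    qed
  qed
qed

definition genus_zero :: "'a set \<Rightarrow> ('a \<Rightarrow> 'a) \<Rightarrow> ('a \<Rightarrow> 'a) \<Rightarrow> bool" where
  "genus_zero D \<sigma> \<alpha> \<longleftrightarrow> euler_sum D \<sigma> \<alpha> = euler_bound D \<sigma> \<alpha>"

text \<open>If \<open>x\<close> and \<open>y\<close> lie on a common face, the split adds a vertex and a face, so by the Euler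
  inequality it must also add a component. This is the Jordan curve theorem of the proof.\<close>

lemma
  assumes D: "finite D" "\<sigma> permutes D" "\<alpha> permutes D" and xy: "x \<in> D" "y \<in> D" "x \<noteq> y"
    and vertex: "(x, y) \<in> conn (graph_on D \<sigma>)" and planar: "genus_zero D \<sigma> \<alpha>"
  shows genus_zero_split: "genus_zero D (transpose x y \<circ> \<sigma>) \<alpha>"
    and genus_zero_split_disconnects: "(x, y) \<in> conn (graph_on D (\<sigma> \<circ> \<alpha>)) \<Longrightarrow>
      (x, y) \<notin> conn (graph_on D (transpose x y \<circ> \<sigma>) \<union> graph_on D \<alpha>)"
proof -
  define \<tau> where "\<tau> = transpose x y \<circ> \<sigma>"
  let ?C = "\<lambda>\<sigma>. component_count D (graph_on D \<sigma> \<union> graph_on D \<alpha>)"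
  have \<tau>: "\<tau> permutes D"
    unfolding \<tau>_def by (intro permutes_compose permutes_swap_id D xy)
  have V: "cycle_count D \<tau> = cycle_count D \<sigma> + 1"
    unfolding \<tau>_def by (rule cycle_count_split[OF D(1,2) xy vertex])
  have \<phi>: "\<sigma> \<circ> \<alpha> permutes D" using D permutes_compose by blast
  have \<tau>\<alpha>: "\<tau> \<circ> \<alpha> = transpose x y \<circ> (\<sigma> \<circ> \<alpha>)" by (simp add: \<tau>_def comp_assoc)
  have "(x, y) \<in> conn (graph_on D \<sigma> \<union> graph_on D \<alpha>)"
    using vertex conn_mono[of "graph_on D \<sigma>"] by blast
  then have C: "component_count D (insert (x, y) (graph_on D \<tau> \<union> graph_on D \<alpha>)) = ?C \<sigma>"
    unfolding \<tau>_def component_count_def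
    using conn_insert_transpose[OF xy(1,2), of \<sigma> "graph_on D \<alpha>"]
    by (simp add: conn_insert_absorb)
  have conn: "(x, y) \<in> conn (graph_on D \<tau> \<union> graph_on D \<alpha>) \<Longrightarrow> ?C \<tau> = ?C \<sigma>"
    using C by (simp add: component_count_def conn_insert_absorb)
  have disc: "(x, y) \<notin> conn (graph_on D \<tau> \<union> graph_on D \<alpha>) \<Longrightarrow> ?C \<tau> = ?C \<sigma> + 1"
    using C component_count_insert[OF D(1) xy(1,2)] by simp
  have ineq: "euler_sum D \<tau> \<alpha> \<le> euler_bound D \<tau> \<alpha>"
    by (rule euler_inequality[OF D(1) \<tau> D(3)])
  have face: "(x, y) \<notin> conn (graph_on D \<tau> \<union> graph_on D \<alpha>) \<and> genus_zero D \<tau> \<alpha>"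
    if "(x, y) \<in> conn (graph_on D (\<sigma> \<circ> \<alpha>))"
  proof -
    have F: "cycle_count D (\<tau> \<circ> \<alpha>) = cycle_count D (\<sigma> \<circ> \<alpha>) + 1"
      unfolding \<tau>\<alpha> by (rule cycle_count_split[OF D(1) \<phi> xy that])
    show ?thesis
      using F V conn disc ineq planar
      by (cases "(x, y) \<in> conn (graph_on D \<tau> \<union> graph_on D \<alpha>)")
        (auto simp: genus_zero_def euler_sum_def euler_bound_def)
  qed
  \<comment> \<open>Corners of two different faces: the split merges these into one face containing
    \<open>x\<close> and \<open>y\<close>. So they remain connected, and the new vertex makes up for
    the lost face.\<close>
  have "genus_zero D \<tau> \<alpha>" if no: "(x, y) \<notin> conn (graph_on D (\<sigma> \<circ> \<alpha>))"
  proof -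
    have F: "cycle_count D (\<sigma> \<circ> \<alpha>) = cycle_count D (\<tau> \<circ> \<alpha>) + 1"
      unfolding \<tau>\<alpha> by (rule cycle_count_merge[OF D(1) \<phi> xy(1,2) no])
    have "(x, y) \<in> conn (graph_on D (\<tau> \<circ> \<alpha>))"
      unfolding \<tau>\<alpha> by (rule conn_transpose_merge[OF D(1) \<phi> xy(1,2) no])
    then have "(x, y) \<in> conn (graph_on D \<tau> \<union> graph_on D \<alpha>)"
      using conn_graph_on_comp[OF D(3)] by blast
    then show ?thesis
      using F V conn planar by (auto simp: genus_zero_def euler_sum_def euler_bound_def)
  qed
  with face show "genus_zero D (transpose x y \<circ> \<sigma>) \<alpha>"
    and "(x, y) \<in> conn (graph_on D (\<sigma> \<circ> \<alpha>)) \<Longrightarrow>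
      (x, y) \<notin> conn (graph_on D (transpose x y \<circ> \<sigma>) \<union> graph_on D \<alpha>)"
    unfolding \<tau>_def by blast+
qed


subsection \<open>From planar diagram codes to combinatorial maps\<close>

text \<open>\<open>other_end\<close>, made the identity outside \<open>D\<close> so that it permutes \<open>D\<close>.\<close>

definition flip_on :: "'a dart set \<Rightarrow> 'a dart \<Rightarrow> 'a dart" where
  "flip_on D d = (if d \<in> D then other_end d else d)"

lemma other_end_simps [simp]:
  "other_end (x, b) = (x, \<not> b)" "fst (other_end d) = fst d"
  "other_end (other_end d) = d" "other_end d \<noteq> d"
  by (auto simp: other_end_def prod_eq_iff)

lemma flip_on_permutes: "flip_on (V \<times> UNIV) permutes (V \<times> UNIV)"
  by (rule bij_imp_permutes) 
    (auto simp: flip_on_def inj_on_def other_end_def bij_betw_def image_iff prod_eq_iff)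

text \<open>The equation with \<open>rotate1\<close> says that the permutation runs around
  \<open>v\<close>; in this form it stays usable when smoothings compose the permutation with
  transpositions. It holds because the vertices are disjoint and each factor moves only its own
  darts.\<close>

lemma rotation_spec:
  assumes "distinct (concat vs)"
  shows "rotation vs permutes set (concat vs)"
    and "v \<in> set vs \<Longrightarrow> map (rotation vs) v = rotate1 v"
proof -
  have "rotation vs permutes set (concat vs) \<and> (\<forall>v\<in>set vs. map (rotation vs) v = rotate1 v)"
    using assms
  proof (induction vs)
    case Nil
    then show ?case by (auto simp: rotation_def permutes_def)
  next
    case (Cons v vs)
    have rot: "rotation (v # vs) = cycle_of_list v \<circ> rotation vs"
      by (simp add: rotation_def)
    have IH: "rotation vs permutes set (concat vs)" "\<And>w. w \<in> set vs \<Longrightarrow> map (rotation vs) w = rotate1 w"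
      using Cons by auto
    have disj: "set v \<inter> set (concat vs) = {}" and dv: "distinct v"
      using Cons.prems by auto
    have "cycle_of_list v permutes set (concat (v # vs))"
      by (rule permutes_subset[OF cycle_permutes]) simp
    moreover have "rotation vs permutes set (concat (v # vs))"
      by (rule permutes_subset[OF IH(1)]) simp
    ultimately have "rotation (v # vs) permutes set (concat (v # vs))"
      unfolding rot by (rule permutes_compose[rotated])
    moreover have "map (rotation (v # vs)) w = rotate1 w" if "w \<in> set (v # vs)" for w
    proof (cases "w = v")
      case True
      have "rotation vs u = u" if "u \<in> set v" for u
        using that disj by (intro permutes_not_in[OF IH(1)]) auto
      then have "map (rotation (v # vs)) v = map (cycle_of_list v) v"
        by (simp add: rot)
      moreover have "map (cycle_of_list v) v = rotate1 v"
        using cyclic_rotation[OF dv, of 1] by simp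
      ultimately show ?thesis using True by metis
    next
      case False
      then have w: "w \<in> set vs" using that by simp
      have "map (rotation (v # vs)) w = map (cycle_of_list v) (rotate1 w)"
        by (simp add: rot IH(2)[OF w, symmetric])
      also have "\<dots> = rotate1 w"
        using disj w by (intro map_idI id_outside_supp) auto
      finally show ?thesis .
    qed
    ultimately show ?case by blast
  qed
  then show "rotation vs permutes set (concat vs)"
    and "v \<in> set vs \<Longrightarrow> map (rotation vs) v = rotate1 v" by auto
qed

lemma conn_rotate1:
  assumes "map \<sigma> v = rotate1 v" "set v \<subseteq> D" "x \<in> set v" "y \<in> set v"
  shows "(x, y) \<in> conn (graph_on D \<sigma>)"
proof -
  have "(v ! 0, v ! i) \<in> conn (graph_on D \<sigma>)" if "i < length v" for i
    using that
  proof (induction i)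
    case (Suc i)
    have "\<sigma> (v ! i) = rotate1 v ! i" using Suc.prems assms(1) by (metis Suc_lessD nth_map)
    also have "\<dots> = v ! Suc i" using Suc.prems by (simp add: nth_rotate1)
    finally have "(v ! i, v ! Suc i) \<in> conn (graph_on D \<sigma>)"
      using Suc.prems assms(2) nth_mem[of i v] by (intro conn_edge) auto
    then show ?case using Suc conn_trans by (metis Suc_lessD)
  qed simp
  then show ?thesis using assms(3,4) conn_sym conn_trans by (metis in_set_conv_nth)
qed

text \<open>Empty vertices are excluded because \<open>length\<close> would count them although they
  own no dart.\<close>

lemma cycle_count_vertices:
  assumes "distinct (concat vs)" "[] \<notin> set vs"
    and "\<And>v. v \<in> set vs \<Longrightarrow> map \<sigma> v = rotate1 v"
  shows "cycle_count (set (concat vs)) \<sigma> = length vs"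
proof -
  let ?D = "set (concat vs)"
  define f where "f d = (THE v. v \<in> set vs \<and> d \<in> set v)" for d
  have f: "f d = v" if "v \<in> set vs" "d \<in> set v" for v d
    unfolding f_def
  proof (rule the_equality)
    fix w assume "w \<in> set vs \<and> d \<in> set w"
    then show "w = v" using that assms(1) by (fastforce simp: distinct_concat_iff)
  qed (use that in simp)
  have "(x, y) \<in> conn (graph_on ?D \<sigma>) \<longleftrightarrow> f x = f y" if xy: "x \<in> ?D" "y \<in> ?D" for x y
  proof
    assume "(x, y) \<in> conn (graph_on ?D \<sigma>)"
    then show "f x = f y"
    proof (rule conn_invariant)
      fix u w assume "(u, w) \<in> graph_on ?D \<sigma>"
      then obtain v where v: "v \<in> set vs" "u \<in> set v" "w = \<sigma> u" by auto
      then have "w \<in> set (map \<sigma> v)" by simp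
      then have "w \<in> set v" by (simp add: assms(3)[OF v(1)] del: set_map)
      with v show "f u = f w" by (simp add: f)
    qed
  next
    assume eq: "f x = f y"
    obtain v w where v: "v \<in> set vs" "x \<in> set v" "w \<in> set vs" "y \<in> set w" using xy by auto
    then have "v = w" using eq f by metis
    then show "(x, y) \<in> conn (graph_on ?D \<sigma>)"
      using v assms(3)[OF v(1)] by (intro conn_rotate1[of _ v]) auto
  qed
  then have "cycle_count ?D \<sigma> = card (f ` ?D)"
    unfolding cycle_count_def by (rule component_count_image)
  also have "f ` ?D = set vs"
  proof (intro equalityI subsetI)
    fix v assume v: "v \<in> set vs"
    then have "hd v \<in> set v" using assms(2) by (metis list.set_sel(1))
    then have "f (hd v) = v" "hd v \<in> ?D" using v f by auto
    then show "v \<in> f ` ?D" by force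
  qed (auto simp: f)
  also have "card (set vs) = length vs"
    using assms(1,2) by (simp add: distinct_card distinct_concat_iff removeAll_id)
  finally show ?thesis .
qed

lemma cycle_count_orbits:
  assumes "finite D" "p permutes D"
  shows "cycle_count D p = card (orbit p ` D)"
  unfolding cycle_count_def
proof (rule component_count_image)
  have perm: "permutation p" using assms permutation_permutes by blast
  fix x y assume "x \<in> D" "y \<in> D"
  have "y \<in> orbit p x \<longleftrightarrow> orbit p x = orbit p y"
  proof
    assume y: "y \<in> orbit p x"
    then have "x \<in> orbit p y"
      by (rule orbit_swap[OF permutation_self_in_orbit[OF perm]])
    with y show "orbit p x = orbit p y"
      by (auto intro: orbit_trans)
  qed (simp add: permutation_self_in_orbit[OF perm])
  then show "(x, y) \<in> conn (graph_on D p) \<longleftrightarrow> orbit p x = orbit p y"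
    using conn_graph_on_iff[OF assms \<open>x \<in> D\<close>] by simp
qed

lemma cycle_count_flip_on: "cycle_count (V \<times> UNIV) (flip_on (V \<times> UNIV)) = card V"
proof -
  let ?D = "V \<times> (UNIV :: bool set)"
  have "cycle_count ?D (flip_on ?D) = card (fst ` ?D)"
    unfolding cycle_count_def
  proof (rule component_count_image)
    fix x y assume xy: "x \<in> ?D" "y \<in> ?D"
    show "(x, y) \<in> conn (graph_on ?D (flip_on ?D)) \<longleftrightarrow> fst x = fst y"
    proof
      assume "fst x = fst y"
      then have "y = x \<or> y = flip_on ?D x"
        using xy by (auto simp: flip_on_def prod_eq_iff other_end_def)
      then show "(x, y) \<in> conn (graph_on ?D (flip_on ?D))"
        using xy by (auto intro: conn_edge)
    qed (erule conn_invariant, auto simp: flip_on_def)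
  qed
  then show ?thesis by simp
qed

text \<open>The permutation \<open>\<sigma>\<close> draws the vertices \<open>vs\<close>, with edges labelled by \<open>V\<close>, on spheres.\<close>

definition planar_drawing :: "'a set \<Rightarrow> 'a dart list list \<Rightarrow> ('a dart \<Rightarrow> 'a dart) \<Rightarrow> bool" where
  "planar_drawing V vs \<sigma> \<longleftrightarrow> finite V \<and> distinct (concat vs) \<and> set (concat vs) = V \<times> UNIV
     \<and> \<sigma> permutes (V \<times> UNIV) \<and> (\<forall>v\<in>set vs. map \<sigma> v = rotate1 v)
     \<and> genus_zero (V \<times> UNIV) \<sigma> (flip_on (V \<times> UNIV))"

text \<open>With E edges there are 2 E darts and \<open>flip_on\<close> has E cycles, so V - E + F =
  2 K is the equation V + E + F = 2 E + 2 K. The faces agree because \<open>other_end\<close> and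
  \<open>flip_on\<close> coincide on the darts of the map.\<close>

lemma planar_map_imp_planar_drawing:
  assumes "planar_map vs" and dist: "distinct (concat vs)" and ne: "[] \<notin> set vs"
    and D: "set (concat vs) = V \<times> UNIV"
  shows "planar_drawing V vs (rotation vs)"
proof -
  let ?D = "V \<times> (UNIV :: bool set)" and ?\<sigma> = "rotation vs"
  let ?\<alpha> = "flip_on ?D"
  have fin: "finite ?D" using D by (metis List.finite_set)
  then have V: "finite V" by (auto simp: finite_cartesian_product_iff)
  have \<sigma>: "?\<sigma> permutes ?D" using rotation_spec(1)[OF dist] D by simp
  have \<phi>: "?\<sigma> \<circ> ?\<alpha> permutes ?D" by (intro permutes_compose flip_on_permutes \<sigma>)
  have "(?\<sigma> \<circ> other_end) d \<in> ?D" if "d \<in> ?D" for d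
    using permutes_in_image[OF \<phi>, of d] that by (simp add: flip_on_def)
  then have "orbit (?\<sigma> \<circ> other_end) d = orbit (?\<sigma> \<circ> ?\<alpha>) d" if "d \<in> ?D" for d
    using that by (intro orbit_cong0[of _ ?D]) (auto simp: flip_on_def)
  then have F: "card (orbit (?\<sigma> \<circ> other_end) ` ?D) = cycle_count ?D (?\<sigma> \<circ> ?\<alpha>)"
    by (simp add: cycle_count_orbits[OF fin \<phi>])
  have "{(d, ?\<sigma> d) | d. d \<in> ?D} \<union> {(d, other_end d) | d. d \<in> ?D} = graph_on ?D ?\<sigma> \<union> graph_on ?D ?\<alpha>"
    by (auto simp: graph_on_def flip_on_def)
  then have K: "component_count ?D (graph_on ?D ?\<sigma> \<union> graph_on ?D ?\<alpha>)
      = card (?D // ({(d, ?\<sigma> d) | d. d \<in> ?D} \<union> {(d, other_end d) | d. d \<in> ?D}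
         \<union> ({(d, ?\<sigma> d) | d. d \<in> ?D} \<union> {(d, other_end d) | d. d \<in> ?D})\<inverse>)\<^sup>*)"
    by (simp only: component_count_def conn_def)
  have "int (length vs) - int (card (fst ` ?D)) + int (cycle_count ?D (?\<sigma> \<circ> ?\<alpha>))
      = 2 * int (component_count ?D (graph_on ?D ?\<sigma> \<union> graph_on ?D ?\<alpha>))"
    using assms(1) unfolding planar_map_def Let_def D F K .
  moreover have "cycle_count ?D ?\<sigma> = length vs"
    using cycle_count_vertices[OF dist ne rotation_spec(2)[OF dist]] D by simp
  moreover have "card ?D = 2 * card V" by (simp add: card_cartesian_product)
  ultimately have "genus_zero ?D ?\<sigma> ?\<alpha>"
    unfolding genus_zero_def euler_sum_def euler_bound_def cycle_count_flip_on by simp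
  then show ?thesis
    unfolding planar_drawing_def using V dist D \<sigma> rotation_spec(2)[OF dist] by blast
qed

lemma planar_drawing_mset_cong:
  assumes "planar_drawing V vs \<sigma>" "mset ws = mset vs"
  shows "planar_drawing V ws \<sigma>"
proof -
  have "mset (concat vs) = (\<Sum>v\<in>#mset vs. mset v)" for vs :: "'a dart list list"
    by (induction vs) auto
  then have "mset (concat ws) = mset (concat vs)" using assms(2) by simp
  from mset_eq_imp_distinct_iff[OF this] mset_eq_setD[OF this] mset_eq_setD[OF assms(2)]
  show ?thesis using assms(1) unfolding planar_drawing_def by simp
qed

text \<open>Starting the cyclic list one dart later gives access to the other smoothing.\<close>

lemma planar_drawing_rotate:
  assumes "planar_drawing V ([p, q, r, s] # vs) \<sigma>"
  shows "planar_drawing V ([q, r, s, p] # vs) \<sigma>"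
  using assms by (auto simp: planar_drawing_def)

text \<open>A smoothing joins neighbouring ends of a crossing. Exchanging the values
  \<open>p\<close> and \<open>r\<close> sends \<open>q\<close> back to \<open>p\<close> and
  \<open>s\<close> back to \<open>r\<close>, which splits the vertex into two of degree 2.\<close>

lemma planar_drawing_smooth:
  assumes pd: "planar_drawing V ([p, q, r, s] # vs) \<sigma>"
  shows "planar_drawing V ([p, q] # [r, s] # vs) (transpose p r \<circ> \<sigma>)"
proof -
  let ?D = "V \<times> (UNIV :: bool set)" and ?\<sigma> = "transpose p r \<circ> \<sigma>"
  have fin: "finite ?D" and dist: "distinct (concat ([p, q, r, s] # vs))"
    and D: "set (concat ([p, q, r, s] # vs)) = ?D" and \<sigma>: "\<sigma> permutes ?D"
    and rot: "\<And>v. v \<in> set ([p, q, r, s] # vs) \<Longrightarrow> map \<sigma> v = rotate1 v"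
    and gz: "genus_zero ?D \<sigma> (flip_on ?D)"
    using pd unfolding planar_drawing_def by auto
  have pr: "p \<in> ?D" "r \<in> ?D" using D by auto
  have vertex: "(p, r) \<in> conn (graph_on ?D \<sigma>)"
    using rot[of "[p, q, r, s]"] D by (intro conn_rotate1[of _ "[p, q, r, s]"]) auto
  have "genus_zero ?D ?\<sigma> (flip_on ?D)"
    by (rule genus_zero_split[OF fin \<sigma> flip_on_permutes pr _ vertex gz]) (use dist in simp)
  moreover have "?\<sigma> permutes ?D"
    by (intro permutes_compose permutes_swap_id \<sigma> pr)
  moreover have "map ?\<sigma> v = rotate1 v" if "v \<in> set ([p, q] # [r, s] # vs)" for v
  proof (cases "v \<in> set vs")
    case True
    have "map ?\<sigma> v = map (transpose p r) (rotate1 v)"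
      using rot[of v] True by (metis list.map_comp list.set_intros(2))
    also have "\<dots> = rotate1 v"
      using dist True by (intro map_idI) (auto simp: transpose_def)
    finally show ?thesis .
  next
    case False
    then show ?thesis using that rot[of "[p, q, r, s]"] dist by (auto simp: transpose_def)
  qed
  ultimately show ?thesis
    using fin dist D pd unfolding planar_drawing_def by simp
qed


section \<open>Crossingless planar drawings are noncrossing matchings\<close>

text \<open>\<open>\<tau>\<close> conjugates \<open>\<psi> = \<tau> \<circ> \<alpha>\<close> to its inverse, so on the \<open>\<psi>\<close>-cycle of a fixed point \<open>b\<close>
  it acts as the reflection \<open>\<psi>\<^sup>k b \<mapsto> \<psi>\<^sup>-\<^sup>k b\<close>. If the cycle had odd length, \<open>\<alpha>\<close>
  would have a fixed point on it; as its length is even, \<open>\<tau>\<close> has exactly two.\<close>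

lemma involutions_fixed_point_partner:
  assumes fin: "finite D" and perm: "\<tau> permutes D" "\<alpha> permutes D"
    and inv: "\<And>x. \<tau> (\<tau> x) = x" "\<And>x. \<alpha> (\<alpha> x) = x" and free: "\<And>x. x \<in> D \<Longrightarrow> \<alpha> x \<noteq> x"
    and b: "b \<in> D" "\<tau> b = b"
  shows "\<exists>h c. 0 < h \<and> c = ((\<tau> \<circ> \<alpha>) ^^ h) b \<and> \<tau> c = c \<and> c \<noteq> b
    \<and> (\<forall>j. 0 < j \<longrightarrow> j < h \<longrightarrow> \<tau> (((\<tau> \<circ> \<alpha>) ^^ j) b) \<noteq> ((\<tau> \<circ> \<alpha>) ^^ j) b)
    \<and> (\<forall>d. (b, d) \<in> conn (graph_on D \<tau> \<union> graph_on D \<alpha>) \<longrightarrow> \<tau> d = d \<longrightarrow> d = b \<or> d = c)"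
proof -
  define \<psi> where "\<psi> = \<tau> \<circ> \<alpha>"
  have \<psi>_apply: "\<psi> x = \<tau> (\<alpha> x)" for x by (simp add: \<psi>_def)
  have \<tau>\<psi>: "\<tau> (\<psi> x) = \<alpha> x" for x by (simp add: \<psi>_def inv)
  have \<psi>: "\<psi> permutes D" unfolding \<psi>_def by (intro permutes_compose perm)
  then have "permutation \<psi>" using fin permutation_permutes by blast
  then have "b \<in> orbit \<psi> b" by (rule permutation_self_in_orbit)
  then have "\<exists>n. 0 < n \<and> (\<psi> ^^ n) b = b" by (auto simp: orbit_altdef)
  then obtain N where N: "0 < N" "(\<psi> ^^ N) b = b" and min: "\<And>m. m < N \<Longrightarrow> 0 < m \<Longrightarrow> (\<psi> ^^ m) b \<noteq> b"
    by (auto simp: exists_least_iff[of "\<lambda>n. 0 < n \<and> (\<psi> ^^ n) b = b"])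
  have inD: "(\<psi> ^^ k) b \<in> D" for k
    using \<psi> b(1) by (simp add: permutes_in_funpow_image)
  have inj: "i = j" if "(\<psi> ^^ i) b = (\<psi> ^^ j) b" "i \<le> j" "j < N" for i j
  proof (rule ccontr)
    assume "i \<noteq> j"
    have "(\<psi> ^^ i) ((\<psi> ^^ (j - i)) b) = (\<psi> ^^ i) b"
      using that by (metis comp_apply funpow_add le_add_diff_inverse)
    then have "(\<psi> ^^ (j - i)) b = b"
      using permutes_inj[OF permutes_funpow[OF \<psi>]] by (metis injD)
    then show False using min[of "j - i"] that \<open>i \<noteq> j\<close> by simp
  qed
  have reflect: "\<tau> ((\<psi> ^^ k) b) = (\<psi> ^^ (N - k)) b" if "k \<le> N" for k
    using that
  proof (induction k)
    case (Suc k)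
    have "\<psi> ((\<psi> ^^ (N - Suc k)) b) = (\<psi> ^^ (N - k)) b"
      using Suc.prems by (metis Suc_diff_Suc Suc_le_lessD comp_apply funpow.simps(2))
    also have "\<dots> = \<tau> ((\<psi> ^^ k) b)" using Suc by simp
    finally have "(\<psi> ^^ (N - Suc k)) b = \<alpha> ((\<psi> ^^ k) b)"
      by (metis \<psi>_apply inv)
    then show ?case by (simp add: \<tau>\<psi>)
  qed (use N b in simp)
  have fixed: "k = 0 \<or> 2 * k = N" if "k < N" "\<tau> ((\<psi> ^^ k) b) = (\<psi> ^^ k) b" for k
  proof (cases "k = 0")
    case False
    have "(\<psi> ^^ (N - k)) b = (\<psi> ^^ k) b" using reflect[of k] that by simp
    then have "N - k = k" using inj[of "N - k" k] inj[of k "N - k"] that False N(1)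
      by (cases "N - k \<le> k") auto
    then show ?thesis using that by linarith
  qed simp
  have "even N"
  proof (rule ccontr)
    assume "odd N"
    then obtain k where k: "N = 2 * k + 1" by (auto elim: oddE)
    have "(\<psi> ^^ Suc k) b = \<tau> ((\<psi> ^^ k) b)" using reflect[of k] k by simp
    then have "\<alpha> ((\<psi> ^^ k) b) = (\<psi> ^^ k) b" by simp (metis \<tau>\<psi> inv(1))
    then show False using free inD by metis
  qed
  then obtain h where h: "N = 2 * h" by (auto elim: evenE)
  define c where "c = (\<psi> ^^ h) b"
  have h0: "0 < h" "h < N" using N h by auto
  have "\<tau> c = c" using reflect[of h] h by (simp add: c_def)
  moreover have "c \<noteq> b" using min[of h] h0 by (simp add: c_def)
  moreover have "\<tau> ((\<psi> ^^ j) b) \<noteq> (\<psi> ^^ j) b" if "0 < j" "j < h" for j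
    using fixed[of j] that h by auto
  moreover have "d = b \<or> d = c" if conn: "(b, d) \<in> conn (graph_on D \<tau> \<union> graph_on D \<alpha>)" and d: "\<tau> d = d" for d
  proof -
    \<comment> \<open>The \<open>\<psi>\<close>-cycle of \<open>b\<close> is closed under both
      involutions, so it is the whole component of \<open>b\<close> and contains every fixed point
      of \<open>\<tau>\<close> there.\<close>
    define S where "S = (\<lambda>k. (\<psi> ^^ k) b) ` {..<N}"
    have mod: "(\<psi> ^^ k) b \<in> S" for k
      using N funpow_mod_eq[of N \<psi> b k] unfolding S_def
      by (metis imageI lessThan_iff mod_less_divisor)
    have \<tau>S: "\<tau> u \<in> S" if "u \<in> S" for u
      using that reflect mod by (auto simp: S_def)
    have \<alpha>S: "\<alpha> u \<in> S" if "u \<in> S" for u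
    proof -
      from that obtain k where "u = (\<psi> ^^ k) b" by (auto simp: S_def)
      then have "\<alpha> u = \<tau> ((\<psi> ^^ Suc k) b)" by (simp add: \<tau>\<psi>)
      then show ?thesis using \<tau>S mod by metis
    qed
    have "b \<in> S" using mod[of 0] by simp
    with conn have "d \<in> S"
      by (rule conn_closed) (use \<tau>S \<alpha>S inv in \<open>auto, metis+\<close>)
    then obtain k where "k < N" "d = (\<psi> ^^ k) b" by (auto simp: S_def)
    then show ?thesis using fixed[of k] d h by (auto simp: c_def)
  qed
  ultimately show ?thesis
    using h0(1) unfolding c_def \<psi>_def by blast
qed

lemma perfect_matching_partner:
  assumes eq: "\<And>i j. i \<in> {1..2 * n} \<Longrightarrow> j \<in> {1..2 * n} \<Longrightarrow> r i j \<longleftrightarrow> j = i \<or> j = p i"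
    and p: "\<And>i. i \<in> {1..2 * n} \<Longrightarrow> p i \<in> {1..2 * n} \<and> p i \<noteq> i"
    and sym: "\<And>i j. r i j \<Longrightarrow> r j i"
  shows "perfect_matching n ((\<lambda>i. {i, p i}) ` {1..2 * n})"
    and "i \<in> {1..2 * n} \<Longrightarrow> {i, j} \<in> (\<lambda>i. {i, p i}) ` {1..2 * n} \<longleftrightarrow> j = p i"
proof -
  have pp: "p (p i) = i" if "i \<in> {1..2 * n}" for i
    using that p eq sym by metis
  show "perfect_matching n ((\<lambda>i. {i, p i}) ` {1..2 * n})"
    unfolding perfect_matching_def
  proof (intro conjI partition_onI ballI)
    show "\<Union> ((\<lambda>i. {i, p i}) ` {1..2 * n}) = {1..2 * n}" using p by auto
    show "disjnt e f" if "e \<in> (\<lambda>i. {i, p i}) ` {1..2 * n}" "f \<in> (\<lambda>i. {i, p i}) ` {1..2 * n}" "e \<noteq> f" for e f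
    proof -
      from that(1,2) obtain i j where ij: "e = {i, p i}" "f = {j, p j}" "p (p i) = i" "p (p j) = j"
        using pp by auto
      have "i \<noteq> j" "i \<noteq> p j" "p i \<noteq> j" "p i \<noteq> p j"
        using ij that(3) by (metis insert_commute)+
      then show ?thesis unfolding ij(1,2) disjnt_def by blast
    qed
    show "card e = 2" if "e \<in> (\<lambda>i. {i, p i}) ` {1..2 * n}" for e
    proof -
      from that obtain i where "e = {i, p i}" "p i \<noteq> i" using p by auto
      then show ?thesis by simp
    qed
  qed auto
  show "{i, j} \<in> (\<lambda>i. {i, p i}) ` {1..2 * n} \<longleftrightarrow> j = p i" if "i \<in> {1..2 * n}"
  proof
    assume "{i, j} \<in> (\<lambda>i. {i, p i}) ` {1..2 * n}"
    then obtain l where "l \<in> {1..2 * n}" "{i, j} = {l, p l}" by blast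
    then show "j = p i" using pp[of l] by (metis doubleton_eq_iff)
  qed (use that in blast)
qed

text \<open>\<open>ds\<close> holds the vertices of degree 2 as pairs of darts, the form in which
  smoothings produce them. That strands match the endpoints in pairs only needs the degrees; genus 0
  enters when two of them are shown not to cross.\<close>

lemma noncrossing_matching_of_drawing:
  fixes bd :: "nat \<Rightarrow> 'a dart"
  assumes pd: "planar_drawing V (rev (map bd (endpoints n)) # map (\<lambda>(d, e). [d, e]) ds) \<sigma>"
  obtains m where "m \<in> noncrossing_matchings n"
    and "\<And>i j. i \<in> {1..2 * n} \<Longrightarrow> j \<in> {1..2 * n} \<Longrightarrow>
      (fst (bd i), fst (bd j)) \<in> conn ((\<lambda>(d, e). (fst d, fst e)) ` set ds) \<longleftrightarrow> i = j \<or> {i, j} \<in> m"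
proof -
  let ?D = "V \<times> (UNIV :: bool set)" and ?I = "{1..2 * n}"
  define B where "B = bd ` ?I"
  let ?bs = "rev (map bd (endpoints n))"
  define \<alpha> where "\<alpha> = flip_on ?D"
  define R where "R = (\<lambda>(d, e). (fst d, fst e)) ` set ds"
  define ps where "ps = map (\<lambda>(d, e). [d, e]) ds"
  have I: "set (endpoints n) = ?I" by (auto simp: endpoints_def)
  have fin: "finite ?D" and dist: "distinct (concat (?bs # ps))"
    and D: "set (concat (?bs # ps)) = ?D" and \<sigma>: "\<sigma> permutes ?D"
    and rot: "\<And>v. v \<in> set (?bs # ps) \<Longrightarrow> map \<sigma> v = rotate1 v"
    and gz: "genus_zero ?D \<sigma> \<alpha>"
    using pd unfolding planar_drawing_def \<alpha>_def ps_def by auto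
  have Bs: "set ?bs = B" by (simp add: B_def I)
  have bd_inj: "inj_on bd ?I" using dist I by (simp add: distinct_map)
  have BD: "B \<subseteq> ?D" unfolding D[symmetric] Bs[symmetric] by simp
  then have bdD: "bd i \<in> ?D" if "i \<in> ?I" for i using that by (auto simp: B_def)
  have pair: "d \<in> ?D \<and> e \<in> ?D \<and> e \<noteq> d \<and> d \<notin> B \<and> e \<notin> B \<and> \<sigma> d = e \<and> \<sigma> e = d"
    if "(d, e) \<in> set ds" for d e
  proof -
    have v: "[d, e] \<in> set ps" using that by (force simp: ps_def)
    then have "set [d, e] \<subseteq> set (concat ps)" unfolding set_concat by blast
    moreover have "set (concat ps) \<inter> B = {}" "set (concat ps) \<subseteq> ?D"
      using dist Bs unfolding D[symmetric] by auto
    moreover have "distinct [d, e]" using v dist by (auto simp: distinct_concat_iff)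
    moreover have "\<sigma> d = e" "\<sigma> e = d" using rot[of "[d, e]"] v by auto
    ultimately show ?thesis by auto
  qed
  have inner: "\<exists>e. \<sigma> d = e \<and> \<sigma> e = d \<and> e \<noteq> d \<and> e \<in> ?D - B \<and> ((d, e) \<in> set ds \<or> (e, d) \<in> set ds)"
    if "d \<in> ?D - B" for d
  proof -
    have "d \<in> set (concat (?bs # ps))" using that D by blast
    moreover have "d \<notin> set ?bs" using that Bs by blast
    ultimately obtain e where "(d, e) \<in> set ds \<or> (e, d) \<in> set ds" by (auto simp: ps_def)
    then show ?thesis using pair by blast
  qed
  \<comment> \<open>The vertex at infinity is cut into its darts. The fixed points of
    \<open>\<tau>\<close> are now exactly the ends of the strands.\<close>
  define \<tau> where "\<tau> d = (if d \<in> B then d else \<sigma> d)" for d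
  have \<tau>_out: "\<tau> d = d" if "d \<notin> ?D" for d using that \<sigma> by (simp add: \<tau>_def permutes_not_in)
  have \<tau>\<tau>: "\<tau> (\<tau> d) = d" for d
    using inner[of d] \<tau>_out[of d] by (cases "d \<in> ?D") (auto simp: \<tau>_def)
  have \<tau>: "\<tau> permutes ?D" using \<tau>_out \<tau>\<tau> unfolding permutes_def by metis
  have \<tau>_fix: "\<tau> d = d \<longleftrightarrow> d \<in> B" if "d \<in> ?D" for d
    using inner[of d] that by (auto simp: \<tau>_def)
  have \<alpha>: "\<alpha> permutes ?D" unfolding \<alpha>_def by (rule flip_on_permutes)
  have \<alpha>\<alpha>: "\<alpha> (\<alpha> d) = d" for d by (auto simp: \<alpha>_def flip_on_def other_end_def)
  have free: "\<alpha> d \<noteq> d" if "d \<in> ?D" for d using that by (simp add: \<alpha>_def flip_on_def)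
  let ?S = "graph_on ?D \<tau> \<union> graph_on ?D \<alpha>"
  have darts: "(u, v) \<in> conn ?S" if "fst u = fst v" "u \<in> ?D" for u v
  proof -
    have "v = u \<or> v = \<alpha> u" using that by (auto simp: \<alpha>_def flip_on_def other_end_def prod_eq_iff)
    then show ?thesis using that by (auto intro: conn_edge)
  qed
  have conn_iff: "(u, v) \<in> conn ?S \<longleftrightarrow> (fst u, fst v) \<in> conn R" if uv: "u \<in> ?D" "v \<in> ?D" for u v
  proof
    assume "(u, v) \<in> conn ?S"
    then show "(fst u, fst v) \<in> conn R"
    proof (rule conn_map)
      fix d e assume "(d, e) \<in> ?S"
      then consider "d \<in> ?D - B" "e = \<sigma> d" | "e = d" | "fst e = fst d"
        by (auto simp: \<tau>_def \<alpha>_def flip_on_def split: if_splits)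
      then show "(fst d, fst e) \<in> conn R"
      proof cases
        case 1
        then have "(d, e) \<in> set ds \<or> (e, d) \<in> set ds" using inner by blast
        then have "(fst d, fst e) \<in> R \<or> (fst e, fst d) \<in> R" unfolding R_def by force
        then show ?thesis using conn_edge conn_sym by metis
      qed simp_all
    qed
  next
    assume "(fst u, fst v) \<in> conn R"
    then have "((fst u, True), (fst v, True)) \<in> conn ?S"
    proof (rule conn_map[where f = "\<lambda>x. (x, True)"])
      fix x y assume "(x, y) \<in> R"
      then obtain d e where de: "(d, e) \<in> set ds" "x = fst d" "y = fst e" by (auto simp: R_def)
      have dD: "d \<in> ?D" "e \<in> ?D" and "\<tau> d = e" using pair[OF de(1)] by (auto simp: \<tau>_def)
      then have "(d, e) \<in> conn ?S" using dD by (intro conn_edge) auto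
      then show "((x, True), (y, True)) \<in> conn ?S"
        using de dD darts[of d "(x, True)"] darts[of e "(y, True)"] conn_sym conn_trans
        by (metis fst_conv)
    qed
    then show "(u, v) \<in> conn ?S"
      using uv darts[of u "(fst u, True)"] darts[of v "(fst v, True)"] conn_sym conn_trans
      by (metis fst_conv)
  qed
  have partner: "\<exists>k. k \<in> ?I \<and> k \<noteq> i \<and> (bd i, \<sigma> (bd k)) \<in> conn (graph_on ?D (\<sigma> \<circ> \<alpha>))
      \<and> (\<forall>j\<in>?I. (fst (bd i), fst (bd j)) \<in> conn R \<longleftrightarrow> j = i \<or> j = k)" if i: "i \<in> ?I" for i
  proof -
    have bi: "bd i \<in> ?D" "\<tau> (bd i) = bd i" using bdD i by (auto simp: \<tau>_def B_def)
    obtain h c where h: "0 < h" and c: "c = ((\<tau> \<circ> \<alpha>) ^^ h) (bd i)" "\<tau> c = c" "c \<noteq> bd i"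
      and before: "\<And>j. 0 < j \<Longrightarrow> j < h \<Longrightarrow> \<tau> (((\<tau> \<circ> \<alpha>) ^^ j) (bd i)) \<noteq> ((\<tau> \<circ> \<alpha>) ^^ j) (bd i)"
      and only: "\<And>d. (bd i, d) \<in> conn ?S \<Longrightarrow> \<tau> d = d \<Longrightarrow> d = bd i \<or> d = c"
      using involutions_fixed_point_partner[OF fin \<tau> \<alpha> \<tau>\<tau> \<alpha>\<alpha> free bi] by blast
    have \<psi>D: "((\<tau> \<circ> \<alpha>) ^^ j) (bd i) \<in> ?D" for j
      using permutes_compose[OF \<alpha> \<tau>] bi(1) by (simp add: permutes_in_funpow_image)
    then have "c \<in> ?D" using c by simp
    then obtain k where k: "k \<in> ?I" "c = bd k" using c \<tau>_fix by (auto simp: B_def)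
    \<comment> \<open>Before the walk along the strand reaches its other end, \<open>\<tau>\<close>
      and \<open>\<sigma>\<close> agree, so it follows a face. In the last step
      \<open>\<tau>\<close> stays at \<open>bd k\<close> while \<open>\<sigma>\<close> moves on, so
      the face is shown to contain \<open>\<sigma> (bd k)\<close>.\<close>
    have walk: "((\<sigma> \<circ> \<alpha>) ^^ j) (bd i) = ((\<tau> \<circ> \<alpha>) ^^ j) (bd i)" if "j < h" for j
      using that
    proof (induction j)
      case (Suc j)
      let ?u = "\<alpha> (((\<tau> \<circ> \<alpha>) ^^ j) (bd i))"
      have "\<tau> (\<tau> ?u) \<noteq> \<tau> ?u" using before[of "Suc j"] Suc.prems by simp
      then have "\<tau> ?u = \<sigma> ?u" by (auto simp: \<tau>_def)
      then show ?case
        using Suc.IH Suc.prems by (metis Suc_lessD comp_apply funpow.simps(2))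
    qed simp
    obtain g where g: "h = Suc g" using h by (cases h) auto
    have "\<tau> (\<alpha> (((\<tau> \<circ> \<alpha>) ^^ g) (bd i))) = c" using c g by simp
    then have "\<alpha> (((\<tau> \<circ> \<alpha>) ^^ g) (bd i)) = c" using c \<tau>\<tau> by metis
    then have "((\<sigma> \<circ> \<alpha>) ^^ h) (bd i) = \<sigma> (bd k)" using walk[of g] g k by simp
    then have face: "(bd i, \<sigma> (bd k)) \<in> conn (graph_on ?D (\<sigma> \<circ> \<alpha>))"
      using conn_funpow[OF permutes_compose[OF \<alpha> \<sigma>] bi(1)] by metis
    have "(bd i, c) \<in> conn (graph_on ?D (\<tau> \<circ> \<alpha>))"
      using conn_funpow[OF permutes_compose[OF \<alpha> \<tau>] bi(1)] c(1) by metis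
    then have ic: "(bd i, c) \<in> conn ?S" using conn_graph_on_comp[OF \<alpha>] by blast
    have "(fst (bd i), fst (bd j)) \<in> conn R \<longleftrightarrow> j = i \<or> j = k" if j: "j \<in> ?I" for j
    proof -
      have "\<tau> (bd j) = bd j" using j by (auto simp: \<tau>_def B_def)
      then have "(bd i, bd j) \<in> conn ?S \<longleftrightarrow> bd j = bd i \<or> bd j = bd k"
        using only[of "bd j"] ic k by auto
      then show ?thesis
        using conn_iff[OF bdD[OF i] bdD[OF j]] bd_inj i j k by (auto dest: inj_onD)
    qed
    then show ?thesis using k c face by blast
  qed
  then have "\<forall>i\<in>?I. \<exists>k. k \<in> ?I \<and> k \<noteq> i \<and> (bd i, \<sigma> (bd k)) \<in> conn (graph_on ?D (\<sigma> \<circ> \<alpha>))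
      \<and> (\<forall>j\<in>?I. (fst (bd i), fst (bd j)) \<in> conn R \<longleftrightarrow> j = i \<or> j = k)"
    by blast
  from bchoice[OF this] obtain p where P: "\<forall>i\<in>?I. p i \<in> ?I \<and> p i \<noteq> i
      \<and> (bd i, \<sigma> (bd (p i))) \<in> conn (graph_on ?D (\<sigma> \<circ> \<alpha>))
      \<and> (\<forall>j\<in>?I. (fst (bd i), fst (bd j)) \<in> conn R \<longleftrightarrow> j = i \<or> j = p i)" ..
  have p: "p i \<in> ?I \<and> p i \<noteq> i"
    and face: "(bd i, \<sigma> (bd (p i))) \<in> conn (graph_on ?D (\<sigma> \<circ> \<alpha>))"
    if "i \<in> ?I" for i using P that by blast+
  have pR: "(fst (bd i), fst (bd j)) \<in> conn R \<longleftrightarrow> j = i \<or> j = p i"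
    if "i \<in> ?I" "j \<in> ?I" for i j using P that by blast
  define m where "m = (\<lambda>i. {i, p i}) ` ?I"
  have pm: "perfect_matching n m"
    and m: "\<And>i j. i \<in> ?I \<Longrightarrow> {i, j} \<in> m \<longleftrightarrow> j = p i"
    unfolding m_def
    using perfect_matching_partner[OF pR p conn_sym] by blast+
  \<comment> \<open>The boundary list is reversed, so \<open>\<sigma>\<close> lowers the index by
    one; the wrap-around from 1 to \<open>2 * n\<close> is left out.\<close>
  have succ: "\<sigma> (bd (Suc i)) = bd i" if "1 \<le> i" "i < 2 * n" for i
  proof -
    let ?k = "2 * n - Suc i"
    have len: "length ?bs = 2 * n" by (simp add: endpoints_def)
    have nth: "?bs ! k = bd (2 * n - k)" if "k < 2 * n" for k
      using that by (simp add: endpoints_def rev_nth Suc_diff_Suc del: upt_Suc)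
    have "\<sigma> (?bs ! ?k) = rotate1 ?bs ! ?k"
      using rot[of ?bs] that len nth_map[of ?k ?bs \<sigma>] by simp
    also have "\<dots> = ?bs ! Suc ?k" using that len by (simp add: nth_rotate1)
    finally show ?thesis using that nth[of ?k] nth[of "Suc ?k"] by (simp add: Suc_diff_Suc)
  qed
  have "noncrossing m"
    unfolding noncrossing_def
  proof clarify
    fix a b c d assume order: "a < b" "b < c" "c < d" and ac: "{a, c} \<in> m" and bd: "{b, d} \<in> m"
    have "\<Union> m = ?I" using pm partition_onD1 unfolding perfect_matching_def by blast
    then have I: "a \<in> ?I" "b \<in> ?I" "c \<in> ?I" "d \<in> ?I" using ac bd by blast+
    \<comment> \<open>The face found above contains \<open>bd a\<close> and the successor of
      \<open>bd c\<close>, which is \<open>bd (c - 1)\<close>. Splitting there leaves the endpoints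
      from \<open>a + 1\<close> to \<open>c - 1\<close> on one vertex, and \<open>a\<close> and
      \<open>c\<close> together on the other.\<close>
    define x y where "x = bd a" and "y = bd (c - 1)"
    have y: "y = \<sigma> (bd c)" using succ[of "c - 1"] order I by (simp add: y_def)
    have c1: "c - 1 \<in> ?I" "a \<noteq> c - 1" using order I by auto
    have xy: "x \<in> ?D" "y \<in> ?D" "x \<noteq> y"
      unfolding x_def y_def using bdD c1 I inj_onD[OF bd_inj] by blast+
    let ?\<sigma> = "transpose x y \<circ> \<sigma>"
    let ?G = "graph_on ?D ?\<sigma> \<union> graph_on ?D \<alpha>"
    have "x \<in> set ?bs" "y \<in> set ?bs" unfolding Bs B_def x_def y_def using c1 I by blast+
    then have vertex: "(x, y) \<in> conn (graph_on ?D \<sigma>)"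
      using rot[of ?bs] D by (intro conn_rotate1[of _ ?bs]) auto
    have "(x, y) \<in> conn (graph_on ?D (\<sigma> \<circ> \<alpha>))"
      using face[of a] m[of a c] I ac by (simp add: x_def y)
    then have sep: "(x, y) \<notin> conn ?G"
      by (rule genus_zero_split_disconnects[OF fin \<sigma> \<alpha> xy vertex gz])
    have arc: "(bd l, bd u) \<in> conn ?G"
      if "1 \<le> l" "l \<le> u" "u \<le> 2 * n" "\<And>i. l \<le> i \<Longrightarrow> i < u \<Longrightarrow> i \<noteq> a \<and> i \<noteq> c - 1" for l u
      using that(2-4)
    proof (induction u rule: dec_induct)
      case (step u)
      have u: "u \<in> ?I" "Suc u \<in> ?I" "u < 2 * n" "1 \<le> u" using step that(1) by auto
      have "u \<noteq> a" "u \<noteq> c - 1" using step by auto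
      then have "bd u \<noteq> x" "bd u \<noteq> y"
        unfolding x_def y_def using inj_onD[OF bd_inj] u(1) c1(1) I(1) by blast+
      then have "?\<sigma> (bd (Suc u)) = bd u" using succ[of u] u by (simp add: transpose_def)
      then have edge: "(bd (Suc u), bd u) \<in> conn ?G"
        using bdD[OF u(2)] by (intro conn_edge) auto
      have "(bd l, bd u) \<in> conn ?G"
      proof (rule step.IH)
        show "i \<noteq> a \<and> i \<noteq> c - 1" if "l \<le> i" "i < u" for i
          using step.prems(2)[of i] that by simp
      qed (use u in simp)
      then show ?case using conn_sym[OF edge] by (rule conn_trans)
    qed simp
    \<comment> \<open>The transposition alters only steps ending at \<open>x\<close> or
      \<open>y\<close>, which are boundary darts; steps along a strand end at inner darts.\<close>
    have strand: "conn ?S \<subseteq> conn ?G"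
    proof (rule conn_least, rule subsetI, clarify)
      fix u v assume uv: "(u, v) \<in> ?S"
      show "(u, v) \<in> conn ?G"
      proof (rule ccontr)
        assume no: "(u, v) \<notin> conn ?G"
        with uv have "u \<in> ?D" "v = \<tau> u" "u \<notin> B"
          by (auto simp: \<tau>_def conn_edge split: if_splits)
        then have "v = \<sigma> u" "v \<notin> B" using inner[of u] by (auto simp: \<tau>_def)
        moreover have "x \<in> B" "y \<in> B" unfolding B_def x_def y_def using c1 I by blast+
        ultimately have "v = ?\<sigma> u" by (auto simp: transpose_def)
        then show False using no \<open>u \<in> ?D\<close> by (auto simp: conn_edge)
      qed
    qed
    have "(fst (bd b), fst (bd d)) \<in> conn R" using pR[of b d] m[of b d] I bd by simp
    then have b_d: "(bd b, bd d) \<in> conn ?G" using conn_iff[OF bdD bdD] I strand by blast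
    have b_y: "(bd b, y) \<in> conn ?G" using arc[of b "c - 1"] order I by (simp add: y_def)
    have c_d: "(bd c, bd d) \<in> conn ?G" using arc[of c d] order I by simp
    have "(bd c, x) \<in> conn ?G"
      using bdD[of c] I by (intro conn_edge) (simp add: y)
    \<comment> \<open>The strand from \<open>b\<close> to \<open>d\<close> would bridge the cut:
      \<open>x\<close>, \<open>bd c\<close>, \<open>bd d\<close>, \<open>bd b\<close>,
      \<open>y\<close>.\<close>
    from conn_trans[OF conn_sym[OF this] conn_trans[OF c_d conn_trans[OF conn_sym[OF b_d] b_y]]]
    have "(x, y) \<in> conn ?G" .
    with sep show False ..
  qed
  then have "m \<in> noncrossing_matchings n"
    using pm by (simp add: noncrossing_matchings_def)
  then show ?thesis
    using that[of m] pR m unfolding R_def by blast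
qed


section \<open>The Kauffman bracket\<close>

text \<open>All that the bracket sees of a list of joins: counting components ignores direction,
  order and repetition.\<close>

definition undirected :: "('a \<times> 'a) list \<Rightarrow> 'a rel" where
  "undirected js = set js \<union> (set js)\<inverse>"

lemma undirected_simps [simp]:
  "undirected [] = {}"
  "undirected ((x, y) # js) = {(x, y), (y, x)} \<union> undirected js"
  "undirected (js @ ks) = undirected js \<union> undirected ks"
  by (auto simp: undirected_def)

lemma circles_cong:
  assumes "undirected js = undirected ks"
  shows "circles js = circles ks"
proof -
  have "Field (set js) = Domain (undirected js)" for js :: "('a \<times> 'a) list"
    by (auto simp: undirected_def Field_def)
  then show ?thesis using assms by (simp add: circles_def flip: undirected_def)
qed

lemma circles_eq_component_count: "circles js = component_count (Field (set js)) (set js)"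
  by (simp add: circles_def component_count_def conn_def)

text \<open>The exponent in \<open>bracket\<close> is a truncated subtraction; positivity is what
  allows closed curves to be split off as a factor.\<close>

lemma circles_pos:
  assumes "set js \<noteq> {}"
  shows "circles js > 0"
proof -
  from assms obtain x y where "(x, y) \<in> set js" by (metis equals0I surj_pair)
  then have "Field (set js) \<noteq> {}" by (auto intro: FieldI1)
  then show ?thesis
    by (auto simp: circles_def card_gt_0_iff quotient_def finite_Field)
qed

lemma bracket_cong: "undirected js = undirected ks \<Longrightarrow> bracket cs js = bracket cs ks"
proof (induction cs arbitrary: js ks)
  case Nil
  then show ?case using circles_cong[OF Nil] by simp
next
  case (Cons x cs)
  obtain a b c d where x: "x = X a b c d" by (cases x)
  have "bracket cs ((u, v) # (w, z) # js) = bracket cs ((u, v) # (w, z) # ks)" for u v w z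
    by (rule Cons.IH) (simp add: Cons.prems)
  then show ?case by (simp add: x)
qed

text \<open>The recursion always opens the leading crossing. Here the crossings of T' are resolved
  while those of T stay in front.\<close>

lemma bracket_resolve:
  "bracket (cs @ X a b c d # cs') js =
     lA * bracket (cs @ cs') ((a, d) # (b, c) # js) + lA_inv * bracket (cs @ cs') ((d, c) # (a, b) # js)"
proof (induction cs arbitrary: js)
  case (Cons x cs)
  obtain p q r s where x: "x = X p q r s" by (cases x)
  have swap: "bracket (cs @ cs') (j1 # j2 # j3 # j4 # js) = bracket (cs @ cs') (j3 # j4 # j1 # j2 # js)"
    for j1 j2 j3 j4
    by (rule bracket_cong) (auto simp: undirected_def)
  show ?case
    by (simp add: x Cons.IH swap[of "(a, d)"] swap[of "(d, c)"] algebra_simps)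
qed simp

text \<open>Reversing both strands turns the picture of a crossing by half a turn, so each smoothing
  joins the same ends. The tail \<open>cs'\<close> is left for the crossings of T', which are not
  reversed.\<close>

lemma bracket_reverse_crossings:
  "bracket (map unoriented (map reverse_crossing cs) @ cs') js = bracket (map unoriented cs @ cs') js"
proof (induction cs arbitrary: js)
  case (Cons x cs)
  obtain a b c d where x: "unoriented x = X a b c d" by (cases "unoriented x")
  then have rx: "unoriented (reverse_crossing x) = X c d a b"
    by (cases x rule: unoriented.cases) auto
  have "bracket cs'' ((c, b) # (d, a) # js) = bracket cs'' ((a, d) # (b, c) # js)"
    "bracket cs'' ((b, a) # (c, d) # js) = bracket cs'' ((d, c) # (a, b) # js)" for cs''
    by (rule bracket_cong, auto)+
  then show ?case using Cons.IH by (simp add: x rx)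
qed simp


section \<open>Gluing a crossingless tangle\<close>

lemma endpoints_set [simp]: "set (endpoints n) = {1..2 * n}"
  by (auto simp: endpoints_def)

lemma perfect_matching_mate:
  assumes m: "perfect_matching n m"
  shows "{i, j} \<in> m \<Longrightarrow> i \<in> {1..2 * n}" and "{i, j} \<in> m \<Longrightarrow> i \<noteq> j"
    and "{i, j} \<in> m \<Longrightarrow> mate m i = j" and "i \<in> {1..2 * n} \<Longrightarrow> {i, mate m i} \<in> m"
proof -
  have U: "\<Union> m = {1..2 * n}" and disj: "disjoint m" and two: "\<And>e. e \<in> m \<Longrightarrow> card e = 2"
    using m by (auto simp: perfect_matching_def partition_on_def)
  show "{i, j} \<in> m \<Longrightarrow> i \<in> {1..2 * n}" using U by blast
  show neq: "{i, j} \<in> m \<Longrightarrow> i \<noteq> j" for i j using two[of "{i, j}"] by auto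
  have "k = j" if "{i, j} \<in> m" "{i, k} \<in> m" for i j k
  proof -
    have "{i, j} = {i, k}" using disjointD[OF disj that] by blast
    then show ?thesis by (metis doubleton_eq_iff)
  qed
  then show mate: "{i, j} \<in> m \<Longrightarrow> mate m i = j" for i j
    unfolding mate_def by (blast intro: the_equality)
  assume "i \<in> {1..2 * n}"
  then obtain e where e: "e \<in> m" "i \<in> e" using U by blast
  from two[OF e(1)] obtain x y where "e = {x, y}" by (auto simp: card_2_iff)
  then have "{i, if i = x then y else x} \<in> m" using e by (auto simp: insert_commute)
  then show "{i, mate m i} \<in> m" using mate by metis
qed

text \<open>The joins that \<open>glue\<close> adds, with orientation forgotten. The endpoint maps
  are parameters so that T and its rotation are treated alike.\<close>

definition seam :: "nat \<Rightarrow> (nat \<Rightarrow> 'a) \<Rightarrow> (nat \<Rightarrow> 'b) \<Rightarrow> (('a + 'b) \<times> ('a + 'b)) list" where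
  "seam n e e' = map (\<lambda>i. (Inl (e i), Inr (e' i))) (endpoints n)"

text \<open>Every arc is listed from both of its ends, so no orientation has to be chosen; the
  repetition does not affect \<open>circles\<close>.\<close>

definition arcs :: "nat \<Rightarrow> (nat \<Rightarrow> 'a) \<Rightarrow> nat set set \<Rightarrow> ('a \<times> 'a) list" where
  "arcs n e m = map (\<lambda>i. (e i, e (mate m i))) (endpoints n)"

text \<open>Contracting each strand of T' to an arc between its endpoints turns the glued diagram
  into the closure by \<open>m\<close>; only the closed curves of T' have to be counted
  apart.\<close>

lemma circles_seam:
  fixes e :: "nat \<Rightarrow> 'a" and e' :: "nat \<Rightarrow> 'b"
  assumes m: "perfect_matching n m"
    and conn: "\<forall>i\<in>{1..2 * n}. \<forall>j\<in>{1..2 * n}.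
      (e' i, e' j) \<in> conn (set ks) \<longleftrightarrow> i = j \<or> {i, j} \<in> m"
  shows "circles (map (map_prod Inl Inl) js @ map (map_prod Inr Inr) ks @ seam n e e')
    = card ((\<lambda>y. conn (set ks) `` {y}) `
        {y \<in> Field (set ks). \<forall>i\<in>{1..2 * n}. (y, e' i) \<notin> conn (set ks)})
      + circles (js @ arcs n e m)"
proof -
  let ?I = "{1..2 * n}"
  define G where "G = set (map (map_prod Inl Inl) js @ map (map_prod Inr Inr) ks @ seam n e e')"
  define J where "J = set (js @ arcs n e m)"
  define K where "K = conn (set ks)"
  define C where "C x = conn J `` {x}" for x
  define closed where "closed y \<longleftrightarrow> (\<forall>i\<in>?I. (y, e' i) \<notin> K)" for y
  \<comment> \<open>Any endpoint on the component of \<open>y\<close> will do: two of them are equal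
    or matched, and matched endpoints are joined by an arc of the closure.\<close>
  define port where "port y = (SOME i. i \<in> ?I \<and> (y, e' i) \<in> K)" for y
  \<comment> \<open>A complete invariant of glued components: a closed curve of T' names itself,
    everything else is named by its component in the closure.\<close>
  define f where "f = case_sum (\<lambda>x. Inl (C x))
    (\<lambda>y. if closed y then Inr (K `` {y}) else Inl (C (e (port y))))"
  have J_mate: "(e i, e j) \<in> conn J" if "{i, j} \<in> m" for i j
  proof (rule conn_edge)
    have "i \<in> ?I" "mate m i = j" using perfect_matching_mate[OF m] that by blast+
    then show "(e i, e j) \<in> J" by (auto simp: J_def arcs_def)
  qed
  have f_Inr: "f (Inr y) = Inl (C (e i))" if "i \<in> ?I" "(y, e' i) \<in> K" for y i
  proof -
    have port: "port y \<in> ?I \<and> (y, e' (port y)) \<in> K"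
      unfolding port_def by (rule someI) (use that in blast)
    then have "(e' (port y), e' i) \<in> K"
      using that conn_sym conn_trans unfolding K_def by metis
    then have "(e (port y), e i) \<in> conn J"
      using conn port that J_mate by (auto simp: K_def)
    moreover have "\<not> closed y" using that by (auto simp: closed_def)
    ultimately show ?thesis by (simp add: f_def C_def conn_class_eq_iff)
  qed
  have lift_K: "(Inr y, Inr z) \<in> conn G" if "(y, z) \<in> K" for y z
    using that unfolding K_def
    by (rule conn_map) (auto intro!: conn_edge simp: G_def image_iff intro: bexI[rotated])
  have seam: "(Inl (e i), Inr (e' i)) \<in> conn G" if "i \<in> ?I" for i
    using that by (intro conn_edge) (auto simp: G_def seam_def)
  have lift_J: "(Inl x, Inl z) \<in> conn G" if "(x, z) \<in> conn J" for x z
    using that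
  proof (rule conn_map)
    fix u v assume "(u, v) \<in> J"
    then consider "(u, v) \<in> set js" | i where "i \<in> ?I" "u = e i" "v = e (mate m i)"
      by (auto simp: J_def arcs_def)
    then show "(Inl u, Inl v) \<in> conn G"
    proof cases
      case 1
      then show ?thesis by (intro conn_edge) (force simp: G_def)
    next
      case 2
      have im: "{i, mate m i} \<in> m" using perfect_matching_mate(4)[OF m 2(1)] .
      then have "mate m i \<in> ?I"
        using perfect_matching_mate(1)[OF m, of "mate m i" i] by (simp add: insert_commute)
      moreover from this have "(Inr (e' i), Inr (e' (mate m i))) \<in> conn G"
        using conn im 2(1) by (intro lift_K) (simp add: K_def)
      ultimately show ?thesis
        using seam[OF 2(1)] seam[of "mate m i"] 2 conn_sym conn_trans by metis
    qed
  qed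
  have f_inv: "f u = f v" if "(u, v) \<in> G" for u v
  proof -
    from that consider x y where "u = Inl x" "v = Inl y" "(x, y) \<in> set js"
      | x y where "u = Inr x" "v = Inr y" "(x, y) \<in> set ks"
      | i where "u = Inl (e i)" "v = Inr (e' i)" "i \<in> ?I"
      by (auto simp: G_def seam_def)
    then show ?thesis
    proof cases
      case 1
      then have "(x, y) \<in> conn J" by (intro conn_edge) (simp add: J_def)
      then show ?thesis using 1 by (simp add: f_def C_def conn_class_eq_iff)
    next
      case 2
      then have xy: "(x, y) \<in> K" by (simp add: K_def conn_edge)
      show ?thesis
      proof (cases "closed x")
        case True
        then have "closed y" using xy conn_trans unfolding closed_def K_def by metis
        then show ?thesis using True xy 2 by (simp add: f_def K_def conn_class_eq_iff)
      next
        case False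
        then obtain i where i: "i \<in> ?I" "(x, e' i) \<in> K" by (auto simp: closed_def)
        then have "(y, e' i) \<in> K" using xy conn_trans conn_sym unfolding K_def by metis
        then show ?thesis using i 2 f_Inr by metis
      qed
    next
      case 3
      have "(e' i, e' i) \<in> K" by (simp add: K_def)
      then show ?thesis using 3 f_Inr[of i "e' i"] by (simp add: f_def)
    qed
  qed
  have cases: "(\<exists>x. (u, Inl x) \<in> conn G \<and> f u = Inl (C x)) \<or> (\<exists>y. u = Inr y \<and> closed y)" for u
  proof (cases u)
    case (Inl x)
    then have "(u, Inl x) \<in> conn G \<and> f u = Inl (C x)" by (simp add: f_def)
    then show ?thesis by blast
  next
    case (Inr y)
    then show ?thesis
    proof (cases "closed y")
      case False
      then obtain i where i: "i \<in> ?I" "(y, e' i) \<in> K" by (auto simp: closed_def)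
      then have "(u, Inl (e i)) \<in> conn G"
        using seam lift_K conn_sym conn_trans Inr by metis
      then show ?thesis using f_Inr[OF i] Inr by blast
    qed simp
  qed
  have "(u, v) \<in> conn G \<longleftrightarrow> f u = f v" for u v
  proof
    assume eq: "f u = f v"
    consider x z where "(u, Inl x) \<in> conn G" "f u = Inl (C x)" "(v, Inl z) \<in> conn G" "f v = Inl (C z)"
      | y z where "u = Inr y" "closed y" "v = Inr z" "closed z"
      | x z where "f u = Inl (C x)" "v = Inr z" "closed z"
      | y z where "u = Inr y" "closed y" "f v = Inl (C z)"
      using cases[of u] cases[of v] by blast
    then show "(u, v) \<in> conn G"
    proof cases
      case 1
      then have "C x = C z" using eq by simp
      then have "(Inl x, Inl z) \<in> conn G" using conn_class_eq_iff[of J x z] by (intro lift_J) (simp add: C_def)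
      then show ?thesis using 1 conn_sym conn_trans by metis
    next
      case 2
      then have "(y, z) \<in> K" using eq by (simp add: f_def K_def conn_class_eq_iff)
      then show ?thesis using 2 lift_K by simp
    qed (use eq in \<open>simp_all add: f_def\<close>)
  qed (erule conn_invariant, erule f_inv)
  then have "component_count (Field G) G = card (f ` Field G)"
    by (intro component_count_image)
  moreover have "component_count (Field J) J = card (C ` Field J)"
    by (intro component_count_image) (simp add: C_def conn_class_eq_iff)
  moreover have "f ` Field G = Inr ` (\<lambda>y. K `` {y}) ` {y \<in> Field (set ks). closed y} \<union> Inl ` C ` Field J"
  proof -
    have mate_I: "mate m i \<in> ?I" if "i \<in> ?I" for i
      using perfect_matching_mate(1)[OF m, of "mate m i" i] perfect_matching_mate(4)[OF m that]
      by (simp add: insert_commute)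
    have FJ: "Field J = Field (set js) \<union> e ` ?I"
      using mate_I by (auto simp: J_def arcs_def Field_def)
    have FG: "Field G = Inl ` Field J \<union> Inr ` (Field (set ks) \<union> e' ` ?I)"
      unfolding FJ by (auto simp: G_def seam_def Field_def image_iff)
    have open_y: "f (Inr y) \<in> Inl ` C ` Field J" if "\<not> closed y" for y
    proof -
      from that obtain i where "i \<in> ?I" "(y, e' i) \<in> K" by (auto simp: closed_def)
      then show ?thesis using f_Inr FJ by auto
    qed
    have not_closed: "\<not> closed (e' i)" if "i \<in> ?I" for i
      using that conn_refl[of "e' i"] unfolding closed_def K_def by blast
    have inl: "f ` Inl ` Field J = Inl ` C ` Field J" by (auto simp: f_def image_image)
    have inr: "f ` Inr ` (Field (set ks) \<union> e' ` ?I) \<subseteq>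
        Inr ` (\<lambda>y. K `` {y}) ` {y \<in> Field (set ks). closed y} \<union> Inl ` C ` Field J"
    proof clarify
      fix y assume "y \<in> Field (set ks) \<union> e' ` ?I" "f (Inr y) \<notin> Inl ` C ` Field J"
      then have "closed y" "y \<in> Field (set ks)" using open_y not_closed by blast+
      then show "f (Inr y) \<in> Inr ` (\<lambda>y. K `` {y}) ` {y \<in> Field (set ks). closed y}"
        by (auto simp: f_def)
    qed
    have "Inr ` (\<lambda>y. K `` {y}) ` {y \<in> Field (set ks). closed y}
        \<subseteq> f ` Inr ` (Field (set ks) \<union> e' ` ?I)"
      by (auto simp: f_def image_iff)
    with inr show ?thesis
      unfolding FG image_Un[of f "Inl ` _"] inl by (simp add: subset_antisym Un_commute le_supI1 le_supI2)
  qed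
  moreover have "finite (Field J)" "finite (Field (set ks))"
    by (simp_all add: J_def finite_Field)
  moreover have "card (Inr ` Q \<union> Inl ` A) = card Q + card A" if "finite Q" "finite A"
    for Q :: "'b set set" and A :: "'a set set"
    using that by (subst card_Un_disjoint) (auto simp: card_image)
  ultimately have "component_count (Field G) G
      = card ((\<lambda>y. K `` {y}) ` {y \<in> Field (set ks). closed y}) + component_count (Field J) J"
    by simp
  then show ?thesis
    by (simp only: circles_eq_component_count G_def J_def K_def closed_def)
qed

text \<open>The factor depends only on the state of T', so it passes unchanged through the recursion
  over the crossings of T.\<close>

lemma bracket_seam:
  fixes e :: "nat \<Rightarrow> 'a" and e' :: "nat \<Rightarrow> 'b"
  assumes n: "n \<ge> 1" and m: "perfect_matching n m"
    and conn: "\<forall>i\<in>{1..2 * n}. \<forall>j\<in>{1..2 * n}.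
      (e' i, e' j) \<in> conn (set ks) \<longleftrightarrow> i = j \<or> {i, j} \<in> m"
  shows "bracket (map (map_crossing Inl) cs)
      (map (map_prod Inl Inl) js @ map (map_prod Inr Inr) ks @ seam n e e')
    = (- (lA ^ 2) - lA_inv ^ 2) ^ card ((\<lambda>y. conn (set ks) `` {y}) `
        {y \<in> Field (set ks). \<forall>i\<in>{1..2 * n}. (y, e' i) \<notin> conn (set ks)})
      * bracket cs (js @ arcs n e m)"
proof (induction cs arbitrary: js)
  case Nil
  \<comment> \<open>At least one arc means at least one circle in the closure, so the 1 in the
    exponent is subtracted there.\<close>
  have "set (js @ arcs n e m) \<noteq> {}" using n by (simp add: arcs_def endpoints_def)
  then have "circles (js @ arcs n e m) > 0" by (rule circles_pos)
  then show ?case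
    unfolding list.map bracket.simps circles_seam[OF m conn] power_add[symmetric] by simp
next
  case (Cons x cs)
  obtain a b c d where x: "x = X a b c d" by (cases x)
  show ?case
    using Cons[of "(a, d) # (b, c) # js"] Cons[of "(d, c) # (a, b) # js"]
    by (simp add: x algebra_simps)
qed

text \<open>\<open>e\<^sub>1\<close> and \<open>e\<^sub>2\<close> are two ways of attaching the same
  T, and \<open>h\<close> takes the writhe factors. The pairs in \<open>ds\<close> consist of darts
  because a smoothing may join two heads or two tails, and the planar drawing must remember which
  ends they are.\<close>

lemma bracket_complement_dvd:
  fixes e\<^sub>1 e\<^sub>2 :: "nat \<Rightarrow> 'a" and bd :: "nat \<Rightarrow> 'b dart"
  assumes n: "n \<ge> 1"
    and closures: "\<And>m. m \<in> noncrossing_matchings n \<Longrightarrow>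
      g dvd h * (bracket cs (js @ arcs n e\<^sub>1 m) - bracket cs (js @ arcs n e\<^sub>2 m))"
    and "planar_drawing V
      (rev (map bd (endpoints n)) # map crossing_vertex ocs @ map (\<lambda>(d, e). [d, e]) ds) \<sigma>"
  shows "g dvd h *
    (bracket (map (map_crossing Inl) cs @ map (map_crossing Inr) (map unoriented ocs))
       (map (map_prod Inl Inl) js @ map (map_prod Inr Inr) (map (map_prod fst fst) ds)
         @ seam n e\<^sub>1 (fst \<circ> bd))
   - bracket (map (map_crossing Inl) cs @ map (map_crossing Inr) (map unoriented ocs))
       (map (map_prod Inl Inl) js @ map (map_prod Inr Inr) (map (map_prod fst fst) ds)
         @ seam n e\<^sub>2 (fst \<circ> bd)))"
  using assms(3)
proof (induction ocs arbitrary: ds \<sigma>)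
  case Nil
  then have pd: "planar_drawing V (rev (map bd (endpoints n)) # map (\<lambda>(d, e). [d, e]) ds) \<sigma>"
    by simp
  obtain m where m: "m \<in> noncrossing_matchings n"
    and conn: "\<And>i j. i \<in> {1..2 * n} \<Longrightarrow> j \<in> {1..2 * n} \<Longrightarrow>
      (fst (bd i), fst (bd j)) \<in> conn ((\<lambda>(d, e). (fst d, fst e)) ` set ds) \<longleftrightarrow> i = j \<or> {i, j} \<in> m"
    using noncrossing_matching_of_drawing[OF pd] by blast
  let ?ks = "map (map_prod fst fst) ds"
  have "set ?ks = (\<lambda>(d, e). (fst d, fst e)) ` set ds" by (auto simp: map_prod_def)
  then have ks: "\<forall>i\<in>{1..2 * n}. \<forall>j\<in>{1..2 * n}.
      ((fst \<circ> bd) i, (fst \<circ> bd) j) \<in> conn (set ?ks) \<longleftrightarrow> i = j \<or> {i, j} \<in> m"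
    using conn by simp
  have pm: "perfect_matching n m" using m by (simp add: noncrossing_matchings_def)
  have alg: "h * (a * x - a * y) = a * (h * (x - y))" for a x y :: laurent
    by (simp add: algebra_simps)
  show ?case
    unfolding list.map(1) append_Nil2 bracket_seam[OF n pm ks] alg
    by (rule dvd_mult[OF closures[OF m]])
next
  case (Cons oc ocs)
  obtain p q r s where v: "crossing_vertex oc = [p, q, r, s]"
    by (cases oc rule: crossing_vertex.cases) (metis crossing_vertex.simps)+
  \<comment> \<open>\<open>X\<close> and \<open>crossing_vertex\<close> list the ends
    counterclockwise from the same one.\<close>
  then have u: "unoriented oc = X (fst p) (fst q) (fst r) (fst s)"
    by (cases oc rule: crossing_vertex.cases) auto
  let ?cs = "map (map_crossing Inl) cs @ map (map_crossing Inr) (map unoriented ocs)"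
  let ?js = "\<lambda>ds e. map (map_prod Inl Inl) js @ map (map_prod Inr Inr) (map (map_prod fst fst) ds)
    @ seam n e (fst \<circ> bd)"
  let ?vs = "rev (map bd (endpoints n)) # map crossing_vertex ocs @ map (\<lambda>(d, e). [d, e]) ds"
  have pd: "planar_drawing V ([p, q, r, s] # ?vs) \<sigma>"
    by (rule planar_drawing_mset_cong[OF Cons.prems]) (simp add: v)
  \<comment> \<open>The A-smoothing joins \<open>q\<close> with \<open>r\<close> and
    \<open>s\<close> with \<open>p\<close>, so the vertex is split at \<open>q\<close> and
    \<open>s\<close>; for B it is split at \<open>p\<close> and \<open>r\<close>.\<close>
  have A: "planar_drawing V
      (rev (map bd (endpoints n)) # map crossing_vertex ocs @ map (\<lambda>(d, e). [d, e]) ((q, r) # (s, p) # ds))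
      (transpose q s \<circ> \<sigma>)"
    by (rule planar_drawing_mset_cong[OF planar_drawing_smooth[OF planar_drawing_rotate[OF pd]]]) simp
  have B: "planar_drawing V
      (rev (map bd (endpoints n)) # map crossing_vertex ocs @ map (\<lambda>(d, e). [d, e]) ((p, q) # (r, s) # ds))
      (transpose p r \<circ> \<sigma>)"
    by (rule planar_drawing_mset_cong[OF planar_drawing_smooth[OF pd]]) simp
  have cA: "bracket ?cs ((Inr (fst p), Inr (fst s)) # (Inr (fst q), Inr (fst r)) # ?js ds e)
      = bracket ?cs (?js ((q, r) # (s, p) # ds) e)" for e
    by (rule bracket_cong) auto
  have cB: "bracket ?cs ((Inr (fst s), Inr (fst r)) # (Inr (fst p), Inr (fst q)) # ?js ds e)
      = bracket ?cs (?js ((p, q) # (r, s) # ds) e)" for e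
    by (rule bracket_cong) auto
  have expand: "bracket (map (map_crossing Inl) cs @ map (map_crossing Inr) (map unoriented (oc # ocs))) (?js ds e)
      = lA * bracket ?cs (?js ((q, r) # (s, p) # ds) e) + lA_inv * bracket ?cs (?js ((p, q) # (r, s) # ds) e)" for e
    by (simp only: list.map u crossing.map bracket_resolve cA cB)
  have "h * ((a * x + b * y) - (a * x' + b * y')) = a * (h * (x - x')) + b * (h * (y - y'))"
    for a b x y x' y' :: laurent
    by (simp add: algebra_simps)
  then show ?case
    unfolding expand using dvd_add[OF dvd_mult[OF Cons.IH[OF A]] dvd_mult[OF Cons.IH[OF B]]]
    by presburger
qed


section \<open>The writhe factor\<close>

lemma lA_inverse: "lA * lA_inv = 1"
  by (simp add: lA_def lA_inv_def mult_single)

lemma writhe_factor_plus_one: "writhe_factor (z + 1) = - (lA_inv ^ 3) * writhe_factor z"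
proof (cases "z \<ge> 0")
  case True
  then have "nat (z + 1) = Suc (nat z)" by simp
  with True show ?thesis by (simp add: writhe_factor_def)
next
  case False
  have unit: "lA_inv ^ 3 * lA ^ 3 = 1"
    by (simp add: lA_inverse mult.commute flip: power_mult_distrib)
  from False have "nat (- z) = Suc (nat (- (z + 1)))" by simp
  then have "- (lA_inv ^ 3) * (- (lA ^ 3)) ^ nat (- z) = (- (lA ^ 3)) ^ nat (- (z + 1))"
    by (simp add: unit flip: mult.assoc)
  with False show ?thesis by (auto simp: writhe_factor_def)
qed

lemma writhe_factor_add: "writhe_factor (a + b) = writhe_factor a * writhe_factor b"
proof (induction a rule: int_induct[where k = 0])
  case base
  then show ?case by (simp add: writhe_factor_def)
next
  case (step1 i)
  then show ?case
    using writhe_factor_plus_one[of i] writhe_factor_plus_one[of "i + b"]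
    by (simp add: algebra_simps)
next
  case (step2 i)
  have unit: "lA ^ 3 * lA_inv ^ 3 = 1"
    by (simp add: lA_inverse flip: power_mult_distrib)
  have minus: "writhe_factor (z - 1) = - (lA ^ 3) * writhe_factor z" for z
    using writhe_factor_plus_one[of "z - 1"] by (simp add: unit flip: mult.assoc)
  have "i - 1 + b = (i + b) - 1" by simp
  then show ?case
    using step2 by (simp only: minus mult.assoc)
qed

lemma writhe_append: "writhe (cs @ cs') = writhe cs + writhe cs'"
  by (simp add: writhe_def)

lemma writhe_map [simp]: "writhe (map (map_oriented_crossing f) cs) = writhe cs"
proof -
  have "positive (map_oriented_crossing f c) = positive c" for c by (cases c) simp
  then show ?thesis by (simp add: writhe_def comp_def)
qed

lemma writhe_reverse [simp]:
  fixes cs :: "'a oriented_crossing list"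
  shows "writhe (map reverse_crossing cs) = writhe cs"
proof -
  have "positive (reverse_crossing c) = positive c" for c :: "'a oriented_crossing" by (cases c) simp
  then show ?thesis by (simp add: writhe_def comp_def)
qed


section \<open>Closures and rotation\<close>

text \<open>A point strictly between \<open>i\<close> and \<open>j\<close> has its mate there too,
  or the two pairs would cross. So the number of these points is even.\<close>

lemma noncrossing_matching_parity:
  assumes m: "m \<in> noncrossing_matchings n" and ij: "{i, j} \<in> m"
  shows "odd i \<noteq> odd j"
proof -
  have pm: "perfect_matching n m" and nc: "noncrossing m"
    using m by (auto simp: noncrossing_matchings_def)
  have U: "\<Union> m = {1..2 * n}" and disj: "disjoint m" and two: "\<And>e. e \<in> m \<Longrightarrow> card e = 2"
    using pm by (auto simp: perfect_matching_def partition_on_def)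
  have less: "odd i \<noteq> odd j" if ij: "{i, j} \<in> m" and "i < j" for i j
  proof -
    define inside where "inside = {e \<in> m. e \<subseteq> {i<..<j}}"
    have "x \<in> \<Union> inside" if x: "x \<in> {i<..<j}" for x
    proof -
      have range: "i \<in> {1..2 * n}" "j \<in> {1..2 * n}" using ij U by blast+
      define y where "y = mate m x"
      have "x \<in> {1..2 * n}" using x range by auto
      then have xy: "{x, y} \<in> m" unfolding y_def by (rule perfect_matching_mate(4)[OF pm])
      have "{x, y} \<noteq> {i, j}" using x by (auto simp: doubleton_eq_iff)
      then have "{x, y} \<inter> {i, j} = {}" using disjointD[OF disj xy ij] by blast
      then have "y \<noteq> i" "y \<noteq> j" by auto
      moreover have "\<not> y < i"
      proof
        assume "y < i"
        then have "y < i \<and> i < x \<and> x < j \<and> {y, x} \<in> m \<and> {i, j} \<in> m"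
          using x xy ij by (simp add: insert_commute)
        then show False using nc unfolding noncrossing_def by blast
      qed
      moreover have "\<not> j < y"
      proof
        assume "j < y"
        then have "i < x \<and> x < j \<and> j < y \<and> {i, j} \<in> m \<and> {x, y} \<in> m"
          using x xy ij by simp
        then show False using nc unfolding noncrossing_def by blast
      qed
      ultimately have "{x, y} \<in> inside" using x xy by (auto simp: inside_def)
      then show ?thesis by blast
    qed
    then have "\<Union> inside = {i<..<j}" by (auto simp: inside_def)
    moreover have "card (\<Union> inside) = (\<Sum>e\<in>inside. card e)"
      using disj by (intro card_Union_disjoint)
        (auto simp: inside_def pairwise_def intro: finite_subset)
    moreover have "(\<Sum>e\<in>inside. card e) = 2 * card inside"
      using two by (simp add: inside_def)
    ultimately have "j - Suc i = 2 * card inside" by simp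
    then show ?thesis using \<open>i < j\<close> by presburger
  qed
  have "i \<noteq> j" using perfect_matching_mate(2)[OF pm ij] .
  then show ?thesis
    using less[of i j] less[of j i] ij by (cases "i < j") (auto simp: insert_commute)
qed

section \<open>Arcs added by a closure\<close>

lemma undirected_arcs:
  assumes "perfect_matching n m"
  shows "undirected (arcs n e m) = {(e i, e j) | i j. {i, j} \<in> m}"
proof -
  have "set (arcs n e m) = {(e i, e j) | i j. {i, j} \<in> m}"
    using perfect_matching_mate[OF assms] by (fastforce simp: arcs_def)
  moreover have "({(e i, e j) | i j. {i, j} \<in> m})\<inverse> = {(e i, e j) | i j. {i, j} \<in> m}"
    by auto (metis insert_commute)+
  ultimately show ?thesis by (simp add: undirected_def)
qed

text \<open>A closure lists its arcs from the outbound, that is odd, endpoints, and by parity each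
  arc has exactly one. Parity is the property asked for because it passes directly to rotated
  matchings.\<close>

lemma undirected_closure_arcs:
  assumes m: "perfect_matching n m" and parity: "\<And>i j. {i, j} \<in> m \<Longrightarrow> odd i \<noteq> odd j"
    and T: "standard_orientation n T"
  shows "undirected (map (\<lambda>i. (endpt T i, endpt T (mate m i))) (filter (outbound T) (endpoints n)))
    = {(endpt T i, endpt T j) | i j. {i, j} \<in> m}"
proof -
  note mate = perfect_matching_mate[OF m]
  have "set (filter (outbound T) (endpoints n)) = {i \<in> {1..2 * n}. odd i}"
    using T unfolding standard_orientation_def set_filter endpoints_set by blast
  then have "set (map (\<lambda>i. (endpt T i, endpt T (mate m i))) (filter (outbound T) (endpoints n)))
      = {(endpt T i, endpt T (mate m i)) | i. i \<in> {1..2 * n} \<and> odd i}"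
    unfolding set_map by blast
  also have "\<dots> = {(endpt T i, endpt T j) | i j. {i, j} \<in> m \<and> odd i}"
  proof (intro equalityI subsetI)
    fix x assume "x \<in> {(endpt T i, endpt T j) | i j. {i, j} \<in> m \<and> odd i}"
    then obtain i j where "{i, j} \<in> m" "odd i" "x = (endpt T i, endpt T j)" by blast
    moreover from this have "i \<in> {1..2 * n}" "mate m i = j" using mate by blast+
    ultimately show "x \<in> {(endpt T i, endpt T (mate m i)) | i. i \<in> {1..2 * n} \<and> odd i}" by blast
  qed (use mate(4) in blast)
  finally have js: "set (map (\<lambda>i. (endpt T i, endpt T (mate m i))) (filter (outbound T) (endpoints n)))
      = {(endpt T i, endpt T j) | i j. {i, j} \<in> m \<and> odd i}" .
  have swap: "{j, i} \<in> m" if "{i, j} \<in> m" for i j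
    using that by (simp add: insert_commute)
  show ?thesis
    unfolding undirected_def js
  proof (intro equalityI subsetI)
    fix z assume "z \<in> {(endpt T i, endpt T j) | i j. {i, j} \<in> m}"
    then obtain i j where ij: "{i, j} \<in> m" "z = (endpt T i, endpt T j)" by blast
    show "z \<in> {(endpt T i, endpt T j) | i j. {i, j} \<in> m \<and> odd i}
        \<union> {(endpt T i, endpt T j) | i j. {i, j} \<in> m \<and> odd i}\<inverse>"
    proof (cases "odd i")
      case False
      then have "odd j" using parity[OF ij(1)] by simp
      then show ?thesis using ij swap by blast
    qed (use ij in blast)
  qed (use swap in blast)
qed

text \<open>\<open>e\<close> and \<open>m'\<close> re-index the arcs: with shifted endpoints, the
  closure by a rotated matching becomes one by the original matching.\<close>

lemma aux_poly_closure:
  assumes m: "perfect_matching n m" "\<And>i j. {i, j} \<in> m \<Longrightarrow> odd i \<noteq> odd j"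
    and T: "standard_orientation n T"
    and e: "{(endpt T i, endpt T j) | i j. {i, j} \<in> m} = {(e i, e j) | i j. {i, j} \<in> m'}"
    and m': "perfect_matching n m'"
  shows "aux_poly (closure_diagram n T m) = writhe_factor (writhe (crossings T))
    * bracket (map unoriented (crossings T)) (joins T @ arcs n e m')"
proof -
  have "bracket (map unoriented (crossings T)) (joins (closure_diagram n T m))
      = bracket (map unoriented (crossings T)) (joins T @ arcs n e m')"
    by (rule bracket_cong)
      (simp add: closure_diagram_def undirected_closure_arcs[OF m T] undirected_arcs[OF m'] e)
  then show ?thesis by (simp add: aux_poly_def closure_diagram_def)
qed

section \<open>Rotation of indices and matchings\<close>

lemma shift_index_bij:
  assumes "n \<ge> 1"
  shows "bij_betw (shift_index n k) {1..2 * n} {1..2 * n}"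
proof -
  have into: "shift_index n k i \<in> {1..2 * n}" for i
    using assms pos_mod_bound[of "2 * int n" "int i - int k - 1"]
    by (auto simp: shift_index_def nat_less_iff Suc_le_eq)
  have inj: "inj_on (shift_index n k) {1..2 * n}"
  proof (rule inj_onI)
    fix i j assume ij: "i \<in> {1..2 * n}" "j \<in> {1..2 * n}" "shift_index n k i = shift_index n k j"
    then have "(int i - int k - 1) mod (2 * int n) = (int j - int k - 1) mod (2 * int n)"
      using assms by (simp add: shift_index_def eq_nat_nat_iff)
    then have "2 * int n dvd int i - int j" by (simp add: mod_eq_dvd_iff)
    then show "i = j" using ij zdvd_not_zless[of "int i - int j" "2 * int n"]
        zdvd_not_zless[of "int j - int i" "2 * int n"]
      by (cases i j rule: linorder_cases) (auto simp: dvd_diff_commute)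
  qed
  have "shift_index n k ` {1..2 * n} = {1..2 * n}"
    using endo_inj_surj[OF _ _ inj] into by blast
  with inj show ?thesis by (simp add: bij_betw_def)
qed

text \<open>The modulus is even, so reduction preserves parity.\<close>

lemma shift_index_parity:
  assumes "n \<ge> 1"
  shows "odd (shift_index n k i) \<longleftrightarrow> odd (i + k)"
proof -
  let ?r = "(int i - int k - 1) mod (2 * int n)"
  have "even ?r \<longleftrightarrow> even (int i - int k - 1)" by (rule dvd_mod_iff) simp
  moreover have "even (nat ?r) \<longleftrightarrow> even ?r" using assms by (simp add: even_nat_iff)
  ultimately show ?thesis by (auto simp: shift_index_def)
qed

lemma rotate_matching_perfect:
  assumes n: "n \<ge> 1" and m: "perfect_matching n m"
  shows "perfect_matching n (rotate_matching n k m)"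
proof -
  have inj: "inj_on (shift_index n k) {1..2 * n}" and img: "shift_index n k ` {1..2 * n} = {1..2 * n}"
    using shift_index_bij[OF n] by (auto simp: bij_betw_def)
  have part: "partition_on {1..2 * n} m" and two: "\<And>e. e \<in> m \<Longrightarrow> card e = 2"
    using m by (auto simp: perfect_matching_def)
  have "card (shift_index n k ` e) = 2" if "e \<in> m" for e
  proof -
    have "e \<subseteq> {1..2 * n}" using part that partition_onD1 by blast
    then show ?thesis using two[OF that] by (simp add: card_image inj_on_subset[OF inj])
  qed
  moreover have "{} \<notin> (`) (shift_index n k) ` m" using partition_onD3[OF part] by auto
  then have "partition_on {1..2 * n} ((`) (shift_index n k) ` m)"
    using partition_on_inj_image[OF part inj] unfolding img by simp
  ultimately show ?thesis by (simp add: perfect_matching_def rotate_matching_def)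
qed

text \<open>Moves the rotation from the matching to the endpoint map \<open>f\<close>, where the
  rotation of the tangle also acts.\<close>

lemma rotate_matching_pairs:
  assumes "perfect_matching n m"
  shows "{(f i, f j) | i j. {i, j} \<in> rotate_matching n k m}
    = {(f (shift_index n k i), f (shift_index n k j)) | i j. {i, j} \<in> m}"
proof -
  have pair_iff: "{i, j} \<in> rotate_matching n k m \<longleftrightarrow>
      (\<exists>a b. {a, b} \<in> m \<and> i = shift_index n k a \<and> j = shift_index n k b)" for i j
  proof
    assume "{i, j} \<in> rotate_matching n k m"
    then obtain e where e: "e \<in> m" "{i, j} = shift_index n k ` e" by (auto simp: rotate_matching_def)
    have "card e = 2" using assms e(1) by (simp add: perfect_matching_def)
    then obtain a b where "e = {a, b}" by (auto simp: card_2_iff)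
    with e show "\<exists>a b. {a, b} \<in> m \<and> i = shift_index n k a \<and> j = shift_index n k b"
      by (auto simp: doubleton_eq_iff) (metis insert_commute)
  next
    assume "\<exists>a b. {a, b} \<in> m \<and> i = shift_index n k a \<and> j = shift_index n k b"
    then obtain a b where ab: "{a, b} \<in> m" "{i, j} = shift_index n k ` {a, b}" by auto
    show "{i, j} \<in> rotate_matching n k m"
      unfolding rotate_matching_def using ab by (intro image_eqI)
  qed
  show ?thesis unfolding pair_iff by blast
qed


section \<open>Gluing in the complement\<close>

text \<open>Heads are the arriving darts and tails the departing ones. Counting with multiplicity
  makes \<open>well_formed\<close> yield distinctness of the darts as well as their set.\<close>

lemma mset_darts:
  "mset (concat (rev (boundary_darts n T) # inner_vertices T))
    = mset (map (\<lambda>x. (x, True)) (heads n T)) + mset (map (\<lambda>x. (x, False)) (tails n T))"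
proof -
  have cs: "mset (concat (map crossing_vertex cs))
      = mset (map (\<lambda>x. (x, True)) (concat (map (\<lambda>c. [over_in c, under_in c]) cs)))
      + mset (map (\<lambda>x. (x, False)) (concat (map (\<lambda>c. [over_out c, under_out c]) cs)))" for cs :: "'a oriented_crossing list"
  proof (induction cs)
    case (Cons c cs)
    then show ?case by (cases c rule: crossing_vertex.cases) auto
  qed simp
  have js: "mset (concat (map (\<lambda>(x, y). [(x, True), (y, False)]) js))
      = mset (map (\<lambda>x. (x, True)) (map fst js)) + mset (map (\<lambda>x. (x, False)) (map snd js))"
    for js :: "('a \<times> 'a) list"
    by (induction js) auto
  have bs: "mset (map (\<lambda>i. (endpt T i, outbound T i)) is)
      = mset (map (\<lambda>x. (x, True)) (map (endpt T) (filter (outbound T) is)))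
      + mset (map (\<lambda>x. (x, False)) (map (endpt T) (filter (\<lambda>i. \<not> outbound T i) is)))" for "is"
    by (induction "is") auto
  show ?thesis
    unfolding heads_def tails_def inner_vertices_def boundary_darts_def map_append mset_append
      concat.simps concat_append mset_rev cs js bs by simp
qed

lemma classical_complement_drawing:
  assumes "n \<ge> 1" "classical_complement n T"
  shows "planar_drawing (set (heads n T)) (rev (boundary_darts n T) # inner_vertices T)
    (rotation (rev (boundary_darts n T) # inner_vertices T))"
proof (rule planar_map_imp_planar_drawing)
  let ?vs = "rev (boundary_darts n T) # inner_vertices T"
  let ?ds = "map (\<lambda>x. (x, True)) (heads n T) @ map (\<lambda>x. (x, False)) (tails n T)"
  have wf: "distinct (heads n T)" "distinct (tails n T)" "set (heads n T) = set (tails n T)"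
    and "planar_map ?vs"
    using assms by (auto simp: classical_complement_def well_formed_def)
  then show "planar_map ?vs" by simp
  have mset: "mset (concat ?vs) = mset ?ds" unfolding mset_append by (rule mset_darts)
  have "distinct ?ds" using wf by (auto simp: distinct_map inj_on_def)
  then show "distinct (concat ?vs)" using mset_eq_imp_distinct_iff[OF mset] by simp
  show "set (concat ?vs) = set (heads n T) \<times> UNIV"
    unfolding mset_eq_setD[OF mset] using wf(3) by (auto simp: image_iff UNIV_bool)
  have "crossing_vertex c \<noteq> []" for c :: "'a oriented_crossing"
    by (cases c rule: crossing_vertex.cases) auto
  \<comment> \<open>For \<open>n = 0\<close> the vertex at infinity would have no dart.\<close>
  moreover have "endpoints n \<noteq> []" using assms(1) by (simp add: endpoints_def)
  ultimately show "[] \<notin> set ?vs"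
    by (auto simp: inner_vertices_def boundary_darts_def) metis
qed

section \<open>The auxiliary polynomial of a glued diagram\<close>

lemma unoriented_map: "unoriented (map_oriented_crossing f c) = map_crossing f (unoriented c)"
  by (cases c rule: unoriented.cases) auto

lemma reverse_crossing_map:
  "reverse_crossing (map_oriented_crossing f c) = map_oriented_crossing f (reverse_crossing c)"
  by (cases c) simp

lemma aux_poly_glue:
  "aux_poly (glue n T T') = writhe_factor (writhe (crossings T)) * writhe_factor (writhe (crossings T'))
    * bracket (map (map_crossing Inl) (map unoriented (crossings T))
        @ map (map_crossing Inr) (map unoriented (crossings T')))
      (map (map_prod Inl Inl) (joins T) @ map (map_prod Inr Inr) (joins T') @ seam n (endpt T) (endpt T'))"
proof -
  have seam: "undirected (map (\<lambda>i. if outbound T i then (Inl (endpt T i), Inr (endpt T' i))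
      else (Inr (endpt T' i), Inl (endpt T i))) is)
    = undirected (map (\<lambda>i. (Inl (endpt T i), Inr (endpt T' i))) is)" for "is"
    by (induction "is") auto
  have "bracket cs (joins (glue n T T')) = bracket cs (map (map_prod Inl Inl) (joins T)
      @ map (map_prod Inr Inr) (joins T') @ seam n (endpt T) (endpt T'))" for cs
    by (rule bracket_cong) (simp add: glue_def seam_def seam)
  moreover have "map unoriented (crossings (glue n T T'))
      = map (map_crossing Inl) (map unoriented (crossings T))
        @ map (map_crossing Inr) (map unoriented (crossings T'))"
    by (simp add: glue_def unoriented_map)
  moreover have "writhe (crossings (glue n T T')) = writhe (crossings T) + writhe (crossings T')"
    by (simp add: glue_def writhe_append)
  ultimately show ?thesis by (simp add: aux_poly_def writhe_factor_add)
qed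

text \<open>The reversal for odd \<open>k\<close> is invisible: crossing signs survive when both
  strands are reversed, and the bracket ignores the direction of crossings, joins and seam. Only the
  shift of the endpoints remains.\<close>

lemma aux_poly_glue_rho:
  fixes T :: "'a tangle" and T' :: "'b tangle"
  shows "aux_poly (glue n (rho n k T) T') = writhe_factor (writhe (crossings T)) * writhe_factor (writhe (crossings T'))
    * bracket (map (map_crossing Inl) (map unoriented (crossings T))
        @ map (map_crossing Inr) (map unoriented (crossings T')))
      (map (map_prod Inl Inl) (joins T) @ map (map_prod Inr Inr) (joins T')
        @ seam n (endpt T \<circ> shift_index n k) (endpt T'))"
proof (cases "even k")
  case True
  then show ?thesis
    unfolding aux_poly_glue by (simp add: rho_def rotate_tangle_def comp_def)
next
  case False
  have rc: "bracket (map (map_crossing f) (map unoriented (map reverse_crossing cs)) @ cs') js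
      = bracket (map (map_crossing f) (map unoriented cs) @ cs') js" for f :: "'x \<Rightarrow> 'y" and cs cs' js
    using bracket_reverse_crossings[of "map (map_oriented_crossing f) cs" cs' js]
    by (simp add: unoriented_map reverse_crossing_map comp_def)
  have "undirected (map (map_prod Inl Inl) (map prod.swap js)) = undirected (map (map_prod Inl Inl) js :: (('a + 'b) \<times> ('a + 'b)) list)"
    for js :: "('a \<times> 'a) list"
    by (induction js) auto
  then have "bracket cs (map (map_prod Inl Inl) (map prod.swap (joins T)) @ ks)
      = bracket cs (map (map_prod Inl Inl) (joins T) @ ks)"
    for cs and ks :: "(('a + 'b) \<times> ('a + 'b)) list"
    by (intro bracket_cong) simp
  moreover have "crossings (rho n k T) = map reverse_crossing (crossings T)"
    "joins (rho n k T) = map prod.swap (joins T)" "endpt (rho n k T) = endpt T \<circ> shift_index n k"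
    using False by (simp_all add: rho_def rotate_tangle_def reverse_tangle_def fun_eq_iff)
  ultimately show ?thesis
    unfolding aux_poly_glue by (simp only: rc writhe_reverse)
qed

theorem proposition3p3:
  fixes n k :: nat and T :: "'a tangle" and T' :: "'b tangle" and g :: laurent
  assumes "n \<ge> 1"
    and "classical_tangle n T"
    and "standard_orientation n T"
    and "classical_complement n T'"
    and "compatible_orientation n T T'"
    and "k > 0"
    and "is_gcd {aux_poly (closure_diagram n T (rotate_matching n k m))
                 - aux_poly (closure_diagram n T m) | m. m \<in> noncrossing_matchings n} g"
  shows "g dvd aux_poly (glue n (rho n k T) T') - aux_poly (glue n T T')"
proof -
  let ?e = "endpt T \<circ> shift_index n k"
  let ?cs = "map unoriented (crossings T)"
  let ?w = "writhe_factor (writhe (crossings T))" and ?w' = "writhe_factor (writhe (crossings T'))"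
  let ?bd = "\<lambda>i. (endpt T' i, outbound T' i)"
  let ?ds = "map (\<lambda>(x, y). ((x, True), (y, False))) (joins T')"
  have closures: "g dvd (?w * ?w') * (bracket ?cs (joins T @ arcs n ?e m)
      - bracket ?cs (joins T @ arcs n (endpt T) m))"
    if m: "m \<in> noncrossing_matchings n" for m
  proof -
    have pm: "perfect_matching n m" using m by (simp add: noncrossing_matchings_def)
    note pairs = rotate_matching_pairs[OF pm]
    \<comment> \<open>Rotation changes both indices of a pair by \<open>k\<close>, so they keep
      opposite parities.\<close>
    have parity: "odd i \<noteq> odd j" if "{i, j} \<in> rotate_matching n k m" for i j
    proof -
      have "(i, j) \<in> {(shift_index n k i, shift_index n k j) | i j. {i, j} \<in> m}"
        using that pairs[where f = "\<lambda>i. i"] by blast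
      then obtain a b where "{a, b} \<in> m" "i = shift_index n k a" "j = shift_index n k b" by blast
      then show ?thesis
        using noncrossing_matching_parity[OF m, of a b] by (simp add: shift_index_parity[OF assms(1)])
    qed
    have "aux_poly (closure_diagram n T (rotate_matching n k m))
        = ?w * bracket ?cs (joins T @ arcs n ?e m)"
    proof (rule aux_poly_closure[OF rotate_matching_perfect[OF assms(1) pm] _ assms(3) _ pm])
      show "{(endpt T i, endpt T j) | i j. {i, j} \<in> rotate_matching n k m}
          = {(?e i, ?e j) | i j. {i, j} \<in> m}"
        unfolding comp_apply by (rule pairs)
    qed (rule parity)
    moreover have "aux_poly (closure_diagram n T m) = ?w * bracket ?cs (joins T @ arcs n (endpt T) m)"
      by (rule aux_poly_closure[OF pm _ assms(3) refl pm]) (rule noncrossing_matching_parity[OF m])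
    moreover have "g dvd aux_poly (closure_diagram n T (rotate_matching n k m))
        - aux_poly (closure_diagram n T m)"
      using assms(7) m by (auto simp: is_gcd_def)
    \<comment> \<open>Closures carry only the writhe factor of T; that of T' is supplied
      here.\<close>
    ultimately have "g dvd ?w' * (?w * bracket ?cs (joins T @ arcs n ?e m)
        - ?w * bracket ?cs (joins T @ arcs n (endpt T) m))"
      by simp
    then show ?thesis by (simp add: algebra_simps)
  qed
  have pd: "planar_drawing (set (heads n T')) (rev (map ?bd (endpoints n))
      # map crossing_vertex (crossings T') @ map (\<lambda>(d, e). [d, e]) ?ds)
      (rotation (rev (boundary_darts n T') # inner_vertices T'))"
    using classical_complement_drawing[OF assms(1,4)]
    by (simp add: inner_vertices_def boundary_darts_def case_prod_unfold comp_def)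
  have ds: "map (map_prod fst fst) ?ds = joins T'" by (simp add: case_prod_unfold comp_def)
  have bd: "fst \<circ> ?bd = endpt T'" by (simp add: fun_eq_iff)
  show ?thesis
    unfolding aux_poly_glue_rho aux_poly_glue[of n T] right_diff_distrib[symmetric]
    by (rule bracket_complement_dvd[OF assms(1) _ pd, unfolded ds bd]) (rule closures)
qed

end
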